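(* Let $G=(V,E,\mu,w)$ be an infinite, connected, stochastically complete weighted graph whose heat kernel $p(t,x,y)$ satisfies $$\int_{1}^{\infty}\frac{p(t,x,y)}{t}\,dt<\infty\qquad\text{for all }x,y\in V .$$ Define $$W_{\log}(x,y):=\mu(x)\mu(y)\int_0^1\frac{p(t,x,y)}{t}\,dt\quad(x\neq y),\qquad W(x,y):=\mu(x)\mu(y)\int_1^\infty\frac{p(t,x,y)}{t}\,dt .$$ These kernels are positive and symmetric, and for every $u\in C_c(V)$ and every $x\in V$, $$\bigl(\log(-\Delta)u\bigr)(x)=\frac1{\mu(x)}\sum_{y\in V,\,y\ne x}W_{\log}(x,y)\bigl(u(x)-u(y)\bigr)-\frac1{\mu(x)}\sum_{y\in V}W(x,y)\,u(y)+\Gamma'(1)\,u(x),$$ where $\Gamma$ is Euler's Gamma function.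
   Context: A weighted graph $G=(V,E,\mu,w)$ consists of a countable vertex set $V$, a positive vertex measure $\mu:V\to(0,\infty)$ and a symmetric edge weight $w:V\times V\to[0,\infty)$ with $w_{xy}=w_{yx}$, $w_{xx}=0$, $w_{xy}>0$ iff $\{x,y\}\in E$ (written $x\sim y$), and $\sum_{y}w_{xy}<\infty$ for all $x$. $C_c(V)$ is the space of finitely supported real functions on $V$. The formal Laplacian is $$\Delta u(x)=\frac1{\mu(x)}\sum_{y\in V}w_{xy}\bigl(u(y)-u(x)\bigr).$$ Standing assumption: $\Delta$ maps $C_c(V)$ into $\ell^2(V,\mu)$ and $\Delta|_{C_c(V)}$ is essentially self-adjoint in $\ell^2(V,\mu)$ (norm $\|u\|^2=\sum_x|u(x)|^2\mu(x)$); its unique self-adjoint extension is again denoted $\Delta$, and $-\Delta$ is self-adjoint with spectrum in $[0,\infty)$. The heat semigroup $e^{t\Delta}$ is defined by functional calculus, and the heat kernel $p(t,x,y)$ is determined by $e^{t\Delta}u(x)=\sum_{y\in V}p(t,x,y)u(y)\mu(y)$, i.e. $p(t,x,y)=\frac{1}{\mu(x)\mu(y)}\langle \mathbf 1_{\{x\}},e^{t\Delta}\mathbf 1_{\{y\}}\rangle_{\ell^2(V,\mu)}$. The graph is stochastically complete if $\sum_{y}p(t,x,y)\mu(y)=1$ for all $t\ge0$, $x\in V$. The logarithmic Laplacian is given by the Bochner-type integral $$\log(-\Delta)u=\int_0^\infty\frac{e^{-t}u-e^{t\Delta}u}{t}\,dt ,$$ so that for $u\in C_c(V)$ and $x\in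 V$, $(\log(-\Delta)u)(x)=\int_0^\infty\frac{e^{-t}u(x)-(e^{t\Delta}u)(x)}{t}\,dt$. (For $u$ with $\int_{(0,\infty)}(\log\lambda)^2\,d\langle E(\lambda)u,u\rangle<\infty$, where $E$ is the spectral measure of $-\Delta$, this agrees with the functional-calculus operator $\int_{(0,\infty)}\log\lambda\,dE(\lambda)u$.) *)

theory Defs
  imports "HOL-Analysis.Analysis"
begin

section \<open>Weighted graphs\<close>

text \<open>The vertex set is the whole type. The edge set is not a separate datum: x and y are adjacent
  iff w x y > 0.\<close>

locale weighted_graph =
  fixes \<mu> :: "'v \<Rightarrow> real" and w :: "'v \<Rightarrow> 'v \<Rightarrow> real"
  assumes countable_vertices: "countable (UNIV :: 'v set)"
    and measure_pos: "\<And>x. \<mu> x > 0"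
    and weight_nonneg: "\<And>x y. w x y \<ge> 0"
    and weight_sym: "\<And>x y. w x y = w y x"
    and weight_irrefl: "\<And>x. w x x = 0"
    and weight_summable: "\<And>x. (\<lambda>y. w x y) summable_on UNIV"

definition connected_graph :: "('v \<Rightarrow> 'v \<Rightarrow> real) \<Rightarrow> bool" where
  "connected_graph w \<longleftrightarrow> (\<forall>x y. (x, y) \<in> {(a, b). w a b > 0}\<^sup>*)"

definition finsupp :: "('v \<Rightarrow> real) set" where
  "finsupp = {u. finite {x. u x \<noteq> 0}}"

definition laplacian :: "('v \<Rightarrow> real) \<Rightarrow> ('v \<Rightarrow> 'v \<Rightarrow> real) \<Rightarrow> ('v \<Rightarrow> real) \<Rightarrow> 'v \<Rightarrow> real" where
  "laplacian \<mu> w u x = 1 / \<mu> x * (\<Sum>\<^sub>\<infinity>y. w x y * (u y - u x))"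


section \<open>The Hilbert space of square-summable functions\<close>

definition l2 :: "('v \<Rightarrow> real) \<Rightarrow> ('v \<Rightarrow> real) set" where
  "l2 \<mu> = {u. (\<lambda>x. (u x)\<^sup>2 * \<mu> x) summable_on UNIV}"

definition l2_inner :: "('v \<Rightarrow> real) \<Rightarrow> ('v \<Rightarrow> real) \<Rightarrow> ('v \<Rightarrow> real) \<Rightarrow> real" where
  "l2_inner \<mu> u v = (\<Sum>\<^sub>\<infinity>x. u x * v x * \<mu> x)"

definition l2_norm :: "('v \<Rightarrow> real) \<Rightarrow> ('v \<Rightarrow> real) \<Rightarrow> real" where
  "l2_norm \<mu> u = sqrt (l2_inner \<mu> u u)"


section \<open>Unbounded operators\<close>

text \<open>An unbounded operator is represented by its graph, a set of pairs (u, A u).\<close>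

type_synonym 'v operator = "(('v \<Rightarrow> real) \<times> ('v \<Rightarrow> real)) set"

definition op_adjoint :: "('v \<Rightarrow> real) \<Rightarrow> 'v operator \<Rightarrow> 'v operator" where
  "op_adjoint \<mu> A = {(v, z). v \<in> l2 \<mu> \<and> z \<in> l2 \<mu> \<and>
     (\<forall>(u, f) \<in> A. l2_inner \<mu> f v = l2_inner \<mu> u z)}"

definition op_closure :: "('v \<Rightarrow> real) \<Rightarrow> 'v operator \<Rightarrow> 'v operator" where
  "op_closure \<mu> A = {(u, f). u \<in> l2 \<mu> \<and> f \<in> l2 \<mu> \<and>
     (\<exists>s g. (\<forall>n::nat. (s n, g n) \<in> A) \<and>
        (\<lambda>n. l2_norm \<mu> (\<lambda>x. s n x - u x)) \<longlonglongrightarrow> 0 \<and>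
        (\<lambda>n. l2_norm \<mu> (\<lambda>x. g n x - f x)) \<longlonglongrightarrow> 0)}"

definition self_adjoint :: "('v \<Rightarrow> real) \<Rightarrow> 'v operator \<Rightarrow> bool" where
  "self_adjoint \<mu> A \<longleftrightarrow> op_adjoint \<mu> A = A"

text \<open>For a densely defined operator such as the Laplacian on finitely supported functions. The
  closure is then the unique self-adjoint extension.\<close>

definition essentially_self_adjoint :: "('v \<Rightarrow> real) \<Rightarrow> 'v operator \<Rightarrow> bool" where
  "essentially_self_adjoint \<mu> A \<longleftrightarrow> self_adjoint \<mu> (op_closure \<mu> A)"

definition op_minus :: "'v operator \<Rightarrow> 'v operator" where
  "op_minus A = {(u, \<lambda>x. - f x) | u f. (u, f) \<in> A}"

definition laplacian_finsupp :: "('v \<Rightarrow> real) \<Rightarrow> ('v \<Rightarrow> 'v \<Rightarrow> real) \<Rightarrow> 'v operator" where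
  "laplacian_finsupp \<mu> w = {(u, laplacian \<mu> w u) | u. u \<in> finsupp}"

definition laplacian_op :: "('v \<Rightarrow> real) \<Rightarrow> ('v \<Rightarrow> 'v \<Rightarrow> real) \<Rightarrow> 'v operator" where
  "laplacian_op \<mu> w = op_closure \<mu> (laplacian_finsupp \<mu> w)"


section \<open>Spectral measures and functional calculus\<close>

definition orthogonal_projection ::
    "('v \<Rightarrow> real) \<Rightarrow> (('v \<Rightarrow> real) \<Rightarrow> ('v \<Rightarrow> real)) \<Rightarrow> bool" where
  "orthogonal_projection \<mu> P \<longleftrightarrow>
     (\<forall>u \<in> l2 \<mu>. P u \<in> l2 \<mu> \<and> P (P u) = P u) \<and>
     (\<forall>u \<in> l2 \<mu>. \<forall>v \<in> l2 \<mu>. \<forall>a b :: real.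
        P (\<lambda>x. a * u x + b * v x) = (\<lambda>x. a * P u x + b * P v x)) \<and>
     (\<forall>u \<in> l2 \<mu>. \<forall>v \<in> l2 \<mu>. l2_inner \<mu> (P u) v = l2_inner \<mu> u (P v))"

definition projection_valued_measure ::
    "('v \<Rightarrow> real) \<Rightarrow> (real set \<Rightarrow> ('v \<Rightarrow> real) \<Rightarrow> ('v \<Rightarrow> real)) \<Rightarrow> bool" where
  "projection_valued_measure \<mu> E \<longleftrightarrow>
     (\<forall>B \<in> sets borel. orthogonal_projection \<mu> (E B)) \<and>
     (\<forall>u \<in> l2 \<mu>. E UNIV u = u) \<and>
     (\<forall>B \<in> sets borel. \<forall>C \<in> sets borel. \<forall>u \<in> l2 \<mu>. E (B \<inter> C) u = E B (E C u)) \<and>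
     (\<forall>B :: nat \<Rightarrow> real set. range B \<subseteq> sets borel \<longrightarrow> disjoint_family B \<longrightarrow>
        (\<forall>u \<in> l2 \<mu>. \<forall>v \<in> l2 \<mu>.
           (\<lambda>n. l2_inner \<mu> (E (B n) u) v) sums l2_inner \<mu> (E (\<Union>n. B n) u) v))"

text \<open>The measure \<open>d\<langle>E(\<lambda>)u,u\<rangle>\<close>, and the integral of f against the signed measure
  \<open>d\<langle>E(\<lambda>)u,v\<rangle>\<close> obtained from it by polarization.\<close>

definition spectral_dist ::
    "('v \<Rightarrow> real) \<Rightarrow> (real set \<Rightarrow> ('v \<Rightarrow> real) \<Rightarrow> ('v \<Rightarrow> real)) \<Rightarrow> ('v \<Rightarrow> real) \<Rightarrow> real measure" where
  "spectral_dist \<mu> E u = measure_of UNIV (sets borel) (\<lambda>B. ennreal (l2_inner \<mu> (E B u) u))"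

definition spectral_integral ::
    "('v \<Rightarrow> real) \<Rightarrow> (real set \<Rightarrow> ('v \<Rightarrow> real) \<Rightarrow> ('v \<Rightarrow> real)) \<Rightarrow> (real \<Rightarrow> real) \<Rightarrow>
       ('v \<Rightarrow> real) \<Rightarrow> ('v \<Rightarrow> real) \<Rightarrow> real" where
  "spectral_integral \<mu> E f u v =
     ((\<integral>l. f l \<partial>spectral_dist \<mu> E (\<lambda>x. u x + v x)) -
      (\<integral>l. f l \<partial>spectral_dist \<mu> E (\<lambda>x. u x - v x))) / 4"

definition spectral_domain ::
    "('v \<Rightarrow> real) \<Rightarrow> (real set \<Rightarrow> ('v \<Rightarrow> real) \<Rightarrow> ('v \<Rightarrow> real)) \<Rightarrow> (real \<Rightarrow> real) \<Rightarrow> ('v \<Rightarrow> real) set" where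
  "spectral_domain \<mu> E f = {u \<in> l2 \<mu>. integrable (spectral_dist \<mu> E u) (\<lambda>l. (f l)\<^sup>2)}"

text \<open>The operator \<open>\<integral> f dE\<close>, given weakly. The test vectors v are taken from the (dense) domain,
  because for other v the two integrals in the polarization formula need not converge separately.\<close>

definition functional_calculus ::
    "('v \<Rightarrow> real) \<Rightarrow> (real set \<Rightarrow> ('v \<Rightarrow> real) \<Rightarrow> ('v \<Rightarrow> real)) \<Rightarrow> (real \<Rightarrow> real) \<Rightarrow> 'v operator" where
  "functional_calculus \<mu> E f = {(u, z). u \<in> spectral_domain \<mu> E f \<and> z \<in> l2 \<mu> \<and>
     (\<forall>v \<in> spectral_domain \<mu> E f. l2_inner \<mu> z v = spectral_integral \<mu> E f u v)}"

definition is_spectral_measure ::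
    "('v \<Rightarrow> real) \<Rightarrow> 'v operator \<Rightarrow> (real set \<Rightarrow> ('v \<Rightarrow> real) \<Rightarrow> ('v \<Rightarrow> real)) \<Rightarrow> bool" where
  "is_spectral_measure \<mu> A E \<longleftrightarrow>
     projection_valued_measure \<mu> E \<and> A = functional_calculus \<mu> E (\<lambda>l. l)"


section \<open>Heat semigroup, heat kernel and logarithmic Laplacian\<close>

text \<open>In this section E stands for the spectral measure of \<open>-\<Delta>\<close>, that is, of
  \<^term>\<open>op_minus (laplacian_op \<mu> w)\<close>.\<close>

definition heat_semigroup ::
    "('v \<Rightarrow> real) \<Rightarrow> (real set \<Rightarrow> ('v \<Rightarrow> real) \<Rightarrow> ('v \<Rightarrow> real)) \<Rightarrow> real \<Rightarrow> ('v \<Rightarrow> real) \<Rightarrow> ('v \<Rightarrow> real)" where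
  "heat_semigroup \<mu> E t u = (THE z. (u, z) \<in> functional_calculus \<mu> E (\<lambda>l. exp (- t * l)))"

definition heat_kernel ::
    "('v \<Rightarrow> real) \<Rightarrow> (real set \<Rightarrow> ('v \<Rightarrow> real) \<Rightarrow> ('v \<Rightarrow> real)) \<Rightarrow> real \<Rightarrow> 'v \<Rightarrow> 'v \<Rightarrow> real" where
  "heat_kernel \<mu> E t x y =
     1 / (\<mu> x * \<mu> y) * l2_inner \<mu> (indicator {x}) (heat_semigroup \<mu> E t (indicator {y}))"

definition stochastically_complete ::
    "('v \<Rightarrow> real) \<Rightarrow> (real set \<Rightarrow> ('v \<Rightarrow> real) \<Rightarrow> ('v \<Rightarrow> real)) \<Rightarrow> bool" where
  "stochastically_complete \<mu> E \<longleftrightarrow>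
     (\<forall>t \<ge> 0. \<forall>x. ((\<lambda>y. heat_kernel \<mu> E t x y * \<mu> y) has_sum 1) UNIV)"

definition log_laplacian_integrand ::
    "('v \<Rightarrow> real) \<Rightarrow> (real set \<Rightarrow> ('v \<Rightarrow> real) \<Rightarrow> ('v \<Rightarrow> real)) \<Rightarrow> ('v \<Rightarrow> real) \<Rightarrow> 'v \<Rightarrow> real \<Rightarrow> real" where
  "log_laplacian_integrand \<mu> E u x t = (exp (- t) * u x - heat_semigroup \<mu> E t u x) / t"

definition log_laplacian ::
    "('v \<Rightarrow> real) \<Rightarrow> (real set \<Rightarrow> ('v \<Rightarrow> real) \<Rightarrow> ('v \<Rightarrow> real)) \<Rightarrow> ('v \<Rightarrow> real) \<Rightarrow> 'v \<Rightarrow> real" where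
  "log_laplacian \<mu> E u x = (LINT t:{0<..}|lborel. log_laplacian_integrand \<mu> E u x t)"

text \<open>Only meaningful for distinct x and y: on the diagonal the integral diverges.\<close>

definition W_log ::
    "('v \<Rightarrow> real) \<Rightarrow> (real set \<Rightarrow> ('v \<Rightarrow> real) \<Rightarrow> ('v \<Rightarrow> real)) \<Rightarrow> 'v \<Rightarrow> 'v \<Rightarrow> real" where
  "W_log \<mu> E x y = \<mu> x * \<mu> y * (LINT t:{0<..1}|lborel. heat_kernel \<mu> E t x y / t)"

definition W_kernel ::
    "('v \<Rightarrow> real) \<Rightarrow> (real set \<Rightarrow> ('v \<Rightarrow> real) \<Rightarrow> ('v \<Rightarrow> real)) \<Rightarrow> 'v \<Rightarrow> 'v \<Rightarrow> real" where
  "W_kernel \<mu> E x y = \<mu> x * \<mu> y * (LINT t:{1..}|lborel. heat_kernel \<mu> E t x y / t)"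

end

theory Submission
  imports Defs
begin

text \<open>Write \<open>p\<close> for the heat kernel. Fix \<open>x\<close> and a finitely supported \<open>u\<close>, and cut the integral
  defining the logarithmic Laplacian at \<open>t = 1\<close>. For \<open>t \<ge> 1\<close> the value of the heat semigroup at
  \<open>x\<close> is a finite sum of terms \<open>p(t,x,y) u(y) \<mu>(y)\<close>, whose integrals against \<open>dt/t\<close> make up the
  kernel \<open>W\<close>. For \<open>t \<le> 1\<close> stochastic completeness turns \<open>u(x)\<close> into a sum over \<open>y\<close> as well, so
  that the integrand is
  \<open>(e\<^sup>-\<^sup>t - 1) u(x) + (\<Sum>y\<noteq>x. p(t,x,y) \<mu>(y) (u(x) - u(y)))\<close> divided by \<open>t\<close>, and integration
  term by term produces \<open>W\<^sub>l\<^sub>o\<^sub>g\<close>. What remains is the number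
  \<open>(\<integral>\<^sub>0\<^sup>1 (e\<^sup>-\<^sup>t - 1)/t dt) + (\<integral>\<^sub>1\<^sup>\<infinity> e\<^sup>-\<^sup>t/t dt)\<close>, which is \<open>\<Gamma>'(1)\<close>: Euler's integral shows
  that it is the limit of \<open>\<Gamma>(s) - 1/s = (\<Gamma>(1 + s) - \<Gamma>(1))/s\<close> as \<open>s\<close> tends to 0
  (\<open>deriv_Gamma_1_integral\<close>).

  Integration term by term rests on two facts: \<open>p \<ge> 0\<close>, and the mass
  \<open>1 - p(t,x,x) \<mu>(x) = (\<Sum>y\<noteq>x. p(t,x,y) \<mu>(y))\<close> that has left \<open>x\<close> is \<open>O(t)\<close>, because the point mass
  at \<open>x\<close> lies in the domain of the Laplacian (\<open>escape_le\<close>). The second fact also makes \<open>p(t,x,y)/t\<close>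
  bounded near 0 for \<open>y \<noteq> x\<close>.

  The substance is the positivity of \<open>p\<close>, which is known only through the spectral measure. From the
  projections \<open>E\<close> a functional calculus for bounded Borel functions is built, with the property that
  applying \<open>g\<close> lands in the domain of \<open>-\<Delta>\<close> as soon as \<open>\<lambda> g(\<lambda>)\<close> is bounded
  (\<open>calculus_in_functional_calculus\<close>). The domain of \<open>\<Delta>\<close> is the closure of the finitely supported
  functions, where the Dirichlet form is an explicit finite sum. Passing to the limit, the form is
  nonnegative, so the spectral measure lives on the half line \<open>\<lambda> \<ge> 0\<close> (\<open>spectrum_nonneg\<close>), and
  \<open>u - s \<Delta>u \<ge> 0\<close> implies \<open>u \<ge> 0\<close> (\<open>maximum_principle\<close>). Hence the resolvents
  \<open>(1 - s \<Delta>)\<^sup>-\<^sup>1\<close> preserve nonnegative functions, and so does the heat semigroup, as a limit of powers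
  of resolvents (\<open>heat_nonneg\<close>). For strict positivity, \<open>p(t,x,y)\<close> behaves like
  \<open>t w(x,y) / (\<mu>(x) \<mu>(y))\<close> for small \<open>t\<close>, so it is positive for adjacent vertices and small
  times; the semigroup law carries this along paths and to all times (\<open>heat_kernel_pos\<close>).\<close>

section \<open>The Hilbert space of square-summable functions\<close>

locale weighted_l2 =
  fixes \<mu> :: "'v \<Rightarrow> real"
  assumes measure_pos: "\<And>x. 0 < \<mu> x"
begin

lemma l2_mult_summable:
  assumes "u \<in> l2 \<mu>" "v \<in> l2 \<mu>"
  shows "(\<lambda>x. u x * v x * \<mu> x) summable_on UNIV"
proof (rule Infinite_Sum.abs_summable_summable, rule Infinite_Sum.abs_summable_on_comparison_test')
  show "(\<lambda>x. (u x)\<^sup>2 * \<mu> x + (v x)\<^sup>2 * \<mu> x) summable_on UNIV"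
    using assms by (intro summable_on_add) (auto simp: l2_def)
  fix x
  have "2 * \<bar>u x * v x\<bar> \<le> (u x)\<^sup>2 + (v x)\<^sup>2"
    using sum_squares_bound[of "\<bar>u x\<bar>" "\<bar>v x\<bar>"] by (simp add: abs_mult mult.assoc)
  hence "\<bar>u x * v x\<bar> \<le> (u x)\<^sup>2 + (v x)\<^sup>2" by linarith
  hence "\<bar>u x * v x\<bar> * \<mu> x \<le> ((u x)\<^sup>2 + (v x)\<^sup>2) * \<mu> x"
    using measure_pos[of x] by (intro mult_right_mono) auto
  thus "norm (u x * v x * \<mu> x) \<le> (u x)\<^sup>2 * \<mu> x + (v x)\<^sup>2 * \<mu> x"
    using measure_pos[of x] by (simp add: abs_mult algebra_simps)
qed

lemma l2_lincomb:
  assumes "u \<in> l2 \<mu>" "v \<in> l2 \<mu>"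
  shows "(\<lambda>x. a * u x + b * v x) \<in> l2 \<mu>"
proof -
  have "(\<lambda>x. a\<^sup>2 * ((u x)\<^sup>2 * \<mu> x) + (2 * a * b) * (u x * v x * \<mu> x) + b\<^sup>2 * ((v x)\<^sup>2 * \<mu> x))
        summable_on UNIV"
    using assms l2_mult_summable[OF assms]
    by (intro summable_on_add summable_on_cmult_right) (auto simp: l2_def)
  thus ?thesis
    by (simp add: l2_def power2_eq_square algebra_simps)
qed

lemma l2_add: "u \<in> l2 \<mu> \<Longrightarrow> v \<in> l2 \<mu> \<Longrightarrow> (\<lambda>x. u x + v x) \<in> l2 \<mu>"
  using l2_lincomb[of u v 1 1] by simp

lemma l2_diff: "u \<in> l2 \<mu> \<Longrightarrow> v \<in> l2 \<mu> \<Longrightarrow> (\<lambda>x. u x - v x) \<in> l2 \<mu>"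
  using l2_lincomb[of u v 1 "-1"] by simp

lemma l2_scale: "u \<in> l2 \<mu> \<Longrightarrow> (\<lambda>x. a * u x) \<in> l2 \<mu>"
  using l2_lincomb[of u u a 0] by simp

lemma l2_inner_commute: "l2_inner \<mu> u v = l2_inner \<mu> v u"
  by (simp add: l2_inner_def mult.commute)

lemma l2_inner_lincomb:
  assumes "u \<in> l2 \<mu>" "v \<in> l2 \<mu>" "z \<in> l2 \<mu>"
  shows "l2_inner \<mu> (\<lambda>x. a * u x + b * v x) z = a * l2_inner \<mu> u z + b * l2_inner \<mu> v z"
proof -
  have "l2_inner \<mu> (\<lambda>x. a * u x + b * v x) z =
      (\<Sum>\<^sub>\<infinity>x. a * (u x * z x * \<mu> x) + b * (v x * z x * \<mu> x))"
    by (simp add: l2_inner_def algebra_simps)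
  also have "\<dots> = a * l2_inner \<mu> u z + b * l2_inner \<mu> v z"
    unfolding l2_inner_def using l2_mult_summable assms
    by (subst infsum_add) (auto intro!: summable_on_cmult_right simp: infsum_cmult_right')
  finally show ?thesis .
qed

lemma l2_inner_lincomb_right:
  assumes "u \<in> l2 \<mu>" "v \<in> l2 \<mu>" "z \<in> l2 \<mu>"
  shows "l2_inner \<mu> z (\<lambda>x. a * u x + b * v x) = a * l2_inner \<mu> z u + b * l2_inner \<mu> z v"
  using l2_inner_lincomb[OF assms] by (metis l2_inner_commute)

lemma l2_inner_diff:
  assumes "u \<in> l2 \<mu>" "v \<in> l2 \<mu>" "z \<in> l2 \<mu>"
  shows "l2_inner \<mu> (\<lambda>x. u x - v x) z = l2_inner \<mu> u z - l2_inner \<mu> v z"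
  using l2_inner_lincomb[OF assms, of 1 "-1"] by simp

lemma l2_inner_diff_right:
  assumes "u \<in> l2 \<mu>" "v \<in> l2 \<mu>" "z \<in> l2 \<mu>"
  shows "l2_inner \<mu> z (\<lambda>x. u x - v x) = l2_inner \<mu> z u - l2_inner \<mu> z v"
  using l2_inner_diff[OF assms] by (metis l2_inner_commute)

lemma l2_inner_self_nonneg: "0 \<le> l2_inner \<mu> u u"
  unfolding l2_inner_def by (intro infsum_nonneg) (simp add: measure_pos less_imp_le)

lemma l2_inner_self_eq_0:
  assumes "u \<in> l2 \<mu>" "l2_inner \<mu> u u = 0"
  shows "u x = 0"
proof -
  have "u x * u x * \<mu> x = 0"
    using nonneg_infsum_le_0D[of "\<lambda>x. u x * u x * \<mu> x" UNIV x] l2_mult_summable[OF assms(1,1)]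
      assms(2) measure_pos by (simp add: l2_inner_def less_imp_le)
  thus ?thesis using measure_pos[of x] by simp
qed

lemma l2_norm_square: "(l2_norm \<mu> u)\<^sup>2 = l2_inner \<mu> u u"
  by (simp add: l2_norm_def l2_inner_self_nonneg)

lemma l2_norm_nonneg: "0 \<le> l2_norm \<mu> u"
  by (simp add: l2_norm_def l2_inner_self_nonneg)

lemma l2_cauchy_schwarz:
  assumes u: "u \<in> l2 \<mu>" and v: "v \<in> l2 \<mu>"
  shows "\<bar>l2_inner \<mu> u v\<bar> \<le> l2_norm \<mu> u * l2_norm \<mu> v"
proof (cases "l2_inner \<mu> v v = 0")
  case True
  have "v x = 0" for x by (rule l2_inner_self_eq_0[OF v True])
  hence "l2_inner \<mu> u v = 0" by (simp add: l2_inner_def)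
  thus ?thesis by (simp add: l2_norm_nonneg)
next
  case False
  define a b c where "a = l2_inner \<mu> u u" and "b = l2_inner \<mu> u v" and "c = l2_inner \<mu> v v"
  have c: "c > 0" using False l2_inner_self_nonneg[of v] by (simp add: c_def)
  \<comment> \<open>Up to the factor c this is the component of u orthogonal to v.\<close>
  let ?z = "\<lambda>x. c * u x + (- b) * v x"
  have z: "?z \<in> l2 \<mu>" by (intro l2_lincomb u v)
  have "0 \<le> l2_inner \<mu> ?z ?z" by (rule l2_inner_self_nonneg)
  also have "\<dots> = c * (c * a - b * b)"
  proof -
    have "l2_inner \<mu> ?z ?z = c * l2_inner \<mu> u ?z + (- b) * l2_inner \<mu> v ?z"
      by (rule l2_inner_lincomb[OF u v z])
    moreover have "l2_inner \<mu> u ?z = c * a + (- b) * b"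
      unfolding a_def b_def by (rule l2_inner_lincomb_right[OF u v u])
    moreover have "l2_inner \<mu> v ?z = c * b + (- b) * c"
      using l2_inner_lincomb_right[OF u v v, of c "- b"] l2_inner_commute[of v u]
      by (simp only: b_def c_def)
    ultimately show ?thesis by (simp only:) (simp add: algebra_simps)
  qed
  finally have "b\<^sup>2 \<le> a * c" using c by (simp add: zero_le_mult_iff power2_eq_square mult.commute)
  hence "sqrt (b\<^sup>2) \<le> sqrt (a * c)" by (rule real_sqrt_le_mono)
  thus ?thesis by (simp add: a_def b_def c_def l2_norm_def real_sqrt_mult)
qed

lemma l2_inner_tendsto:
  assumes s: "\<And>n::nat. s n \<in> l2 \<mu>" and g: "\<And>n. g n \<in> l2 \<mu>" and u: "u \<in> l2 \<mu>" and f: "f \<in> l2 \<mu>"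
    and su: "(\<lambda>n. l2_norm \<mu> (\<lambda>x. s n x - u x)) \<longlonglongrightarrow> 0"
    and gf: "(\<lambda>n. l2_norm \<mu> (\<lambda>x. g n x - f x)) \<longlonglongrightarrow> 0"
  shows "(\<lambda>n. l2_inner \<mu> (s n) (g n)) \<longlonglongrightarrow> l2_inner \<mu> u f"
proof -
  let ?a = "\<lambda>n. l2_norm \<mu> (\<lambda>x. s n x - u x)" and ?b = "\<lambda>n. l2_norm \<mu> (\<lambda>x. g n x - f x)"
  have est: "\<bar>l2_inner \<mu> (s n) (g n) - l2_inner \<mu> u f\<bar>
      \<le> ?a n * ?b n + ?a n * l2_norm \<mu> f + l2_norm \<mu> u * ?b n" for n
  proof -
    have "l2_inner \<mu> (s n) (g n) - l2_inner \<mu> u f =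
        l2_inner \<mu> (\<lambda>x. s n x - u x) (\<lambda>x. g n x - f x) + l2_inner \<mu> (\<lambda>x. s n x - u x) f
        + l2_inner \<mu> u (\<lambda>x. g n x - f x)"
      using l2_inner_diff[OF s[of n] u l2_diff[OF g[of n] f]] l2_inner_diff[OF s[of n] u f]
        l2_inner_diff_right[OF g[of n] f s[of n]] l2_inner_diff_right[OF g[of n] f u] by linarith
    thus ?thesis
      using l2_cauchy_schwarz[OF l2_diff[OF s[of n] u] l2_diff[OF g[of n] f]]
        l2_cauchy_schwarz[OF l2_diff[OF s[of n] u] f]
        l2_cauchy_schwarz[OF u l2_diff[OF g[of n] f]] by linarith
  qed
  have lim: "(\<lambda>n. ?a n * ?b n + ?a n * l2_norm \<mu> f + l2_norm \<mu> u * ?b n) \<longlonglongrightarrow> 0"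
    using su gf by (auto intro!: tendsto_eq_intros)
  have "(\<lambda>n. l2_inner \<mu> (s n) (g n) - l2_inner \<mu> u f) \<longlonglongrightarrow> 0"
    by (rule Lim_null_comparison[OF always_eventually[OF allI] lim]) (simp add: est)
  thus ?thesis by (simp add: LIM_zero_iff)
qed

lemma
  assumes v: "v \<in> l2 \<mu>" and le: "\<And>x. \<bar>u x\<bar> \<le> \<bar>v x\<bar>"
  shows l2_dominated: "u \<in> l2 \<mu>" and l2_norm_mono: "l2_norm \<mu> u \<le> l2_norm \<mu> v"
proof -
  have sq: "(u x)\<^sup>2 * \<mu> x \<le> (v x)\<^sup>2 * \<mu> x" for x
    using le[of x] measure_pos[of x] by (intro mult_right_mono) (auto simp: abs_le_square_iff)
  show u: "u \<in> l2 \<mu>"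
    unfolding l2_def mem_Collect_eq
    by (rule summable_on_comparison_test[where f = "\<lambda>x. (v x)\<^sup>2 * \<mu> x"])
       (use v sq measure_pos in \<open>auto simp: l2_def less_imp_le\<close>)
  show "l2_norm \<mu> u \<le> l2_norm \<mu> v"
    unfolding l2_norm_def l2_inner_def using u v sq
    by (intro real_sqrt_le_mono infsum_mono) (auto simp: l2_def power2_eq_square)
qed

lemma finsupp_in_l2: "u \<in> finsupp \<Longrightarrow> u \<in> l2 \<mu>"
  unfolding finsupp_def l2_def
  by (auto intro!: finite_nonzero_values_imp_summable_on elim!: rev_finite_subset)

lemma indicator_finsupp: "(indicator {x} :: 'v \<Rightarrow> real) \<in> finsupp"
  by (simp add: finsupp_def indicator_def)

lemma indicator_in_l2: "(indicator {x} :: 'v \<Rightarrow> real) \<in> l2 \<mu>"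
  by (intro finsupp_in_l2 indicator_finsupp)

lemma l2_inner_indicator: "l2_inner \<mu> u (indicator {x}) = u x * \<mu> x"
proof -
  have "l2_inner \<mu> u (indicator {x}) = (\<Sum>\<^sub>\<infinity>y\<in>{x}. u y * \<mu> y)"
    unfolding l2_inner_def by (intro infsum_cong_neutral) (auto simp: indicator_def)
  thus ?thesis by simp
qed

text \<open>The Riesz representation theorem. Since the point masses are a basis, the representing vector
  is explicit; testing the functional on its truncations bounds its norm.\<close>

lemma riesz_representation:
  fixes L :: "('v \<Rightarrow> real) \<Rightarrow> real"
  assumes lin: "\<And>a b u v. u \<in> l2 \<mu> \<Longrightarrow> v \<in> l2 \<mu> \<Longrightarrow> L (\<lambda>x. a * u x + b * v x) = a * L u + b * L v"
    and bound: "\<And>v. v \<in> l2 \<mu> \<Longrightarrow> \<bar>L v\<bar> \<le> C * l2_norm \<mu> v"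
  shows "(\<lambda>x. L (indicator {x}) / \<mu> x) \<in> l2 \<mu>"
    and "v \<in> l2 \<mu> \<Longrightarrow> l2_inner \<mu> (\<lambda>x. L (indicator {x}) / \<mu> x) v = L v"
proof -
  define z where "z = (\<lambda>x. L (indicator {x}) / \<mu> x)"
  define cut where "cut = (\<lambda>F (v :: 'v \<Rightarrow> real) x. if x \<in> F then v x else 0)"
  have cut_fin: "finite F \<Longrightarrow> cut F v \<in> finsupp" for F v
    by (auto simp: finsupp_def cut_def intro: rev_finite_subset)
  have L_cut: "L (cut F v) = (\<Sum>x\<in>F. v x * z x * \<mu> x)" if "finite F" for F v
    using that
  proof (induction F rule: finite_induct)
    case empty
    have "L (cut {} v) = 0 * L (cut {} v) + 0 * L (cut {} v)"
      using lin[OF finsupp_in_l2[OF cut_fin] finsupp_in_l2[OF cut_fin], of "{}" "{}" 0 v 0 v]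
      by (simp add: cut_def)
    thus ?case by simp
  next
    case (insert y F)
    have "cut (insert y F) v = (\<lambda>x. v y * indicator {y} x + 1 * cut F v x)"
      using insert by (auto simp: cut_def indicator_def fun_eq_iff)
    hence "L (cut (insert y F) v) = v y * L (indicator {y}) + 1 * L (cut F v)"
      using lin[OF indicator_in_l2 finsupp_in_l2[OF cut_fin[OF insert(1)]], of "v y" y 1 v] by simp
    thus ?case using insert measure_pos[of y] by (simp add: z_def field_simps)
  qed
  have norm_cut: "l2_inner \<mu> (cut F v) (cut F v) = (\<Sum>x\<in>F. (v x)\<^sup>2 * \<mu> x)" if "finite F" for F v
  proof -
    have "l2_inner \<mu> (cut F v) (cut F v) = (\<Sum>\<^sub>\<infinity>x\<in>F. (v x)\<^sup>2 * \<mu> x)"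
      unfolding l2_inner_def
      by (intro infsum_cong_neutral) (auto simp: cut_def power2_eq_square)
    thus ?thesis using that by simp
  qed
  have z: "z \<in> l2 \<mu>"
    unfolding l2_def mem_Collect_eq
  proof (rule nonneg_bdd_above_summable_on)
    show "bdd_above (sum (\<lambda>x. (z x)\<^sup>2 * \<mu> x) ` {F. F \<subseteq> UNIV \<and> finite F})"
    proof (rule bdd_aboveI2)
      fix F :: "'v set" assume "F \<in> {F. F \<subseteq> UNIV \<and> finite F}"
      hence F: "finite F" by simp
      define N where "N = (\<Sum>x\<in>F. (z x)\<^sup>2 * \<mu> x)"
      have N: "N \<ge> 0" unfolding N_def by (intro sum_nonneg) (simp add: measure_pos less_imp_le)
      have "N = L (cut F z)" by (simp add: L_cut[OF F] N_def power2_eq_square)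
      also have "\<dots> \<le> C * sqrt N"
        using bound[OF finsupp_in_l2[OF cut_fin[OF F, of z]]]
        by (simp add: l2_norm_def norm_cut[OF F] N_def[symmetric])
      finally have "sqrt N * sqrt N \<le> C * sqrt N" using N by simp
      hence "sqrt N \<le> \<bar>C\<bar>"
        using N real_sqrt_ge_zero[OF N] by (cases "sqrt N = 0") (simp_all only: mult_le_cancel_right, auto)
      hence "(sqrt N)\<^sup>2 \<le> \<bar>C\<bar>\<^sup>2" using N by (intro power_mono) auto
      thus "(\<Sum>x\<in>F. (z x)\<^sup>2 * \<mu> x) \<le> C\<^sup>2" using N by (simp add: N_def)
    qed
  qed (simp add: measure_pos less_imp_le)
  have repr: "l2_inner \<mu> z v = L v" if v: "v \<in> l2 \<mu>" for v
  proof -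
    have sq: "((\<lambda>F. \<Sum>x\<in>F. v x * v x * \<mu> x) \<longlongrightarrow> l2_inner \<mu> v v) (finite_subsets_at_top UNIV)"
      unfolding l2_inner_def by (intro infsum_tendsto l2_mult_summable v)
    have "((\<lambda>F. \<Sum>x\<in>F. v x * z x * \<mu> x) \<longlongrightarrow> l2_inner \<mu> v z) (finite_subsets_at_top UNIV)"
      unfolding l2_inner_def by (intro infsum_tendsto l2_mult_summable v z)
    moreover have "((\<lambda>F. \<Sum>x\<in>F. v x * z x * \<mu> x) \<longlongrightarrow> L v) (finite_subsets_at_top UNIV)"
    proof -
      have est: "\<bar>(\<Sum>x\<in>F. v x * z x * \<mu> x) - L v\<bar>
          \<le> C * sqrt (l2_inner \<mu> v v - (\<Sum>x\<in>F. v x * v x * \<mu> x))" if F: "finite F" for F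
      proof -
        let ?c = "cut F v"
        have c: "?c \<in> l2 \<mu>" by (intro finsupp_in_l2 cut_fin F)
        have vc: "l2_inner \<mu> v ?c = l2_inner \<mu> ?c ?c"
          unfolding l2_inner_def by (intro infsum_cong) (simp add: cut_def)
        have d: "(\<lambda>x. v x - ?c x) \<in> l2 \<mu>" by (intro l2_diff v c)
        have "l2_inner \<mu> (\<lambda>x. v x - ?c x) (\<lambda>x. v x - ?c x) = l2_inner \<mu> v v - l2_inner \<mu> ?c ?c"
          using l2_inner_diff[OF v c d] l2_inner_diff_right[OF v c v] l2_inner_diff_right[OF v c c]
            vc l2_inner_commute[of ?c v] by linarith
        moreover have "L (\<lambda>x. v x - ?c x) = L v - L ?c" using lin[OF v c, of 1 "-1"] by simp
        ultimately show ?thesis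
          using bound[OF d] L_cut[OF F, of v]
          by (simp add: l2_norm_def norm_cut[OF F] power2_eq_square abs_minus_commute)
      qed
      have "((\<lambda>F. C * sqrt (l2_inner \<mu> v v - (\<Sum>x\<in>F. v x * v x * \<mu> x))) \<longlongrightarrow> C * sqrt 0)
          (finite_subsets_at_top UNIV)"
        using tendsto_diff[OF tendsto_const sq, of "l2_inner \<mu> v v"]
        by (intro tendsto_mult tendsto_const tendsto_real_sqrt) simp
      hence "((\<lambda>F. C * sqrt (l2_inner \<mu> v v - (\<Sum>x\<in>F. v x * v x * \<mu> x))) \<longlongrightarrow> 0)
          (finite_subsets_at_top UNIV)" by simp
      hence "((\<lambda>F. (\<Sum>x\<in>F. v x * z x * \<mu> x) - L v) \<longlongrightarrow> 0) (finite_subsets_at_top UNIV)"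
        by (rule Lim_null_comparison[rotated])
           (auto intro!: eventually_finite_subsets_at_top_weakI est)
      thus ?thesis by (simp add: LIM_zero_iff)
    qed
    ultimately show ?thesis
      using tendsto_unique[OF finite_subsets_at_top_neq_bot] l2_inner_commute[of z v] by fastforce
  qed
  show "(\<lambda>x. L (indicator {x}) / \<mu> x) \<in> l2 \<mu>" using z by (simp add: z_def)
  show "v \<in> l2 \<mu> \<Longrightarrow> l2_inner \<mu> (\<lambda>x. L (indicator {x}) / \<mu> x) v = L v"
    using repr by (simp add: z_def)
qed

end

section \<open>Bounded Borel functional calculus\<close>

definition bounded_borel :: "(real \<Rightarrow> real) \<Rightarrow> bool" where
  "bounded_borel g \<longleftrightarrow> g \<in> borel_measurable borel \<and> (\<exists>C. \<forall>l. \<bar>g l\<bar> \<le> C)"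

lemma bounded_borelI: "g \<in> borel_measurable borel \<Longrightarrow> (\<And>l. \<bar>g l\<bar> \<le> C) \<Longrightarrow> bounded_borel g"
  by (auto simp: bounded_borel_def)

lemma bounded_borel_measurable: "bounded_borel g \<Longrightarrow> g \<in> borel_measurable borel"
  by (simp add: bounded_borel_def)

lemma bounded_borel_bound:
  assumes "bounded_borel g"
  obtains C where "0 \<le> C" "\<And>l. \<bar>g l\<bar> \<le> C"
proof -
  obtain C where "\<And>l. \<bar>g l\<bar> \<le> C" using assms by (auto simp: bounded_borel_def)
  moreover from this have "0 \<le> C" using abs_ge_zero[of "g 0"] order_trans by blast
  ultimately show ?thesis using that by blast
qed

lemma bounded_borel_indicator: "B \<in> sets borel \<Longrightarrow> bounded_borel (indicator B)"
  by (intro bounded_borelI[of _ 1]) (auto simp: indicator_def)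

lemma bounded_borel_lincomb:
  assumes "bounded_borel f" "bounded_borel g"
  shows "bounded_borel (\<lambda>l. a * f l + b * g l)"
proof -
  obtain C D where C: "\<And>l. \<bar>f l\<bar> \<le> C" and D: "\<And>l. \<bar>g l\<bar> \<le> D"
    using assms by (auto simp: bounded_borel_def)
  show ?thesis
  proof (rule bounded_borelI)
    show "\<bar>a * f l + b * g l\<bar> \<le> \<bar>a\<bar> * C + \<bar>b\<bar> * D" for l
      using mult_left_mono[OF C[of l], of "\<bar>a\<bar>"] mult_left_mono[OF D[of l], of "\<bar>b\<bar>"]
        abs_triangle_ineq[of "a * f l" "b * g l"] by (simp add: abs_mult)
  qed (use assms in \<open>auto simp: bounded_borel_def\<close>)
qed

lemma bounded_borel_mult:
  assumes "bounded_borel f" "bounded_borel g"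
  shows "bounded_borel (\<lambda>l. f l * g l)"
proof -
  obtain C D where C: "0 \<le> C" "\<And>l. \<bar>f l\<bar> \<le> C" and D: "0 \<le> D" "\<And>l. \<bar>g l\<bar> \<le> D"
    using assms by (metis bounded_borel_bound)
  show ?thesis
    by (rule bounded_borelI[of _ "C * D"])
       (use assms C D in \<open>auto simp: bounded_borel_def abs_mult intro!: mult_mono\<close>)
qed

text \<open>Every bounded Borel function is a uniform limit of simple functions, obtained by rounding its values
  down to multiples of \<open>1/n\<close>. An identity that is linear and continuous under bounded pointwise
  convergence need therefore only be checked on indicators, that is, on the projections \<open>E B\<close>. All
  algebraic properties of the calculus below are proved in this way, which avoids any explicit use of
  the signed measures \<open>d\<langle>E(\<lambda>)u,v\<rangle>\<close>.\<close>

lemma bounded_borel_induct [consumes 1, case_names indicator lincomb limit]: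
  assumes g: "bounded_borel g"
    and ind: "\<And>B. B \<in> sets borel \<Longrightarrow> P (indicator B)"
    and lincomb: "\<And>f g a b. bounded_borel f \<Longrightarrow> bounded_borel g \<Longrightarrow> P f \<Longrightarrow> P g \<Longrightarrow>
                    P (\<lambda>l. a * f l + b * g l)"
    and limit: "\<And>f g C. (\<And>n::nat. bounded_borel (f n)) \<Longrightarrow> (\<And>n. P (f n)) \<Longrightarrow>
                    (\<And>n l. \<bar>f n l\<bar> \<le> C) \<Longrightarrow> bounded_borel g \<Longrightarrow>
                    (\<And>l. (\<lambda>n. f n l) \<longlonglongrightarrow> g l) \<Longrightarrow> P g"
  shows "P g"
proof -
  have simple: "bounded_borel (\<lambda>l. \<Sum>k\<in>I. c k * indicator (B k) l) \<and>
      P (\<lambda>l. \<Sum>k\<in>I. c k * indicator (B k) l)"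
    if "finite I" "\<And>k. B k \<in> sets borel" for I :: "int set" and c :: "int \<Rightarrow> real" and B
    using that
  proof (induction I rule: finite_induct)
    case empty
    have "P (\<lambda>l. 0 * indicator {} l + 0 * indicator {} l)"
      by (intro lincomb bounded_borel_indicator ind) auto
    thus ?case by (simp add: bounded_borelI[of _ 0])
  next
    case (insert k I)
    have "bounded_borel (\<lambda>l. c k * indicator (B k) l + 1 * (\<Sum>j\<in>I. c j * indicator (B j) l))"
      using insert by (intro bounded_borel_lincomb bounded_borel_indicator) auto
    moreover have "P (\<lambda>l. c k * indicator (B k) l + 1 * (\<Sum>j\<in>I. c j * indicator (B j) l))"
      using insert by (intro lincomb bounded_borel_indicator ind) auto
    ultimately show ?case by (simp only: sum.insert[OF insert(1,2)] mult_1)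
  qed
  obtain C where C: "0 \<le> C" "\<And>l. \<bar>g l\<bar> \<le> C" using bounded_borel_bound[OF g] by blast
  have meas [measurable]: "g \<in> borel_measurable borel" by (rule bounded_borel_measurable[OF g])
  define r where "r = (\<lambda>n. real (Suc n))"
  have r: "r n > 0" for n by (simp add: r_def)
  define K where "K = (\<lambda>n. {\<lfloor>- (r n * C)\<rfloor> .. \<lfloor>r n * C\<rfloor>})"
  define B where "B = (\<lambda>n k. {l. \<lfloor>r n * g l\<rfloor> = k})"
  have B: "B n k \<in> sets borel" for n k
    unfolding B_def by measurable
  define f where "f = (\<lambda>n l. \<Sum>k\<in>K n. (of_int k / r n) * indicator (B n k) l)"
  have f_eq: "f n l = of_int \<lfloor>r n * g l\<rfloor> / r n" for n l
  proof -
    have "r n * \<bar>g l\<bar> \<le> r n * C" using C(2)[of l] r[of n] by (intro mult_left_mono) auto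
    moreover have "\<bar>r n * g l\<bar> = r n * \<bar>g l\<bar>" using r[of n] by (simp add: abs_mult)
    ultimately have "- (r n * C) \<le> r n * g l" "r n * g l \<le> r n * C" by linarith+
    hence "\<lfloor>r n * g l\<rfloor> \<in> K n" unfolding K_def by (auto intro: floor_mono)
    have "f n l = (\<Sum>k\<in>K n. if k = \<lfloor>r n * g l\<rfloor> then of_int k / r n else 0)"
      unfolding f_def by (intro sum.cong) (auto simp: B_def)
    also have "\<dots> = of_int \<lfloor>r n * g l\<rfloor> / r n"
      using \<open>\<lfloor>r n * g l\<rfloor> \<in> K n\<close> by (simp add: K_def sum.delta')
    finally show ?thesis .
  qed
  have close: "\<bar>f n l - g l\<bar> \<le> inverse (r n)" for n l
  proof -
    have "f n l - g l = (of_int \<lfloor>r n * g l\<rfloor> - r n * g l) / r n"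
      using r[of n] by (simp add: f_eq field_simps)
    hence "\<bar>f n l - g l\<bar> = \<bar>of_int \<lfloor>r n * g l\<rfloor> - r n * g l\<bar> / r n"
      using r[of n] by simp
    also have "\<dots> \<le> 1 / r n"
    proof (rule divide_right_mono)
      show "\<bar>of_int \<lfloor>r n * g l\<rfloor> - r n * g l\<bar> \<le> 1" by linarith
    qed (use r[of n] in auto)
    finally show ?thesis by (simp add: inverse_eq_divide)
  qed
  show "P g"
  proof (rule limit[of f])
    show "bounded_borel (f n)" "P (f n)" for n
      using simple[of "K n" "B n" "\<lambda>k. of_int k / r n"] B by (auto simp: f_def K_def)
    show "\<bar>f n l\<bar> \<le> C + 1" for n l
    proof -
      have "inverse (r n) \<le> 1" by (simp add: r_def field_simps)
      thus ?thesis using close[of n l] C(2)[of l] by linarith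
    qed
    show "(\<lambda>n. f n l) \<longlonglongrightarrow> g l" for l
    proof (rule LIM_zero_cancel, rule Lim_null_comparison[OF always_eventually[OF allI]])
      show "norm (f n l - g l) \<le> inverse (real (Suc n))" for n
        using close[of n l] by (simp add: r_def)
    qed (rule LIMSEQ_inverse_real_of_nat)
  qed (rule g)
qed

lemma abs_le_one_plus_square: "\<bar>l\<bar> \<le> 1 + (l::real)\<^sup>2"
  using sum_squares_bound[of 1 "\<bar>l\<bar>"] abs_ge_zero[of l] by simp

text \<open>Identities for the measures \<open>d\<langle>E(\<lambda>)u,u\<rangle>\<close> are available for bounded functions. Together with this
  lemma, which is monotone convergence, they give integrability of unbounded functions.\<close>

lemma integrable_from_truncations:
  fixes f :: "real \<Rightarrow> real"
  assumes fin: "finite_measure M" and sets: "sets M = sets borel"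
    and meas: "f \<in> borel_measurable borel" and nonneg: "\<And>l. 0 \<le> f l"
    and bound: "\<And>n::nat. (\<integral>l. f l * indicator {l. f l \<le> real n} l \<partial>M) \<le> K"
  shows "integrable M f"
proof -
  interpret finite_measure M by (rule fin)
  let ?f = "\<lambda>(n::nat) l. f l * indicator {l. f l \<le> real n} l"
  have [measurable]: "f \<in> borel_measurable M" using meas measurable_cong_sets[OF sets refl] by blast
  have int: "integrable M (?f n)" for n
  proof (rule integrable_const_bound)
    show "AE l in M. norm (?f n l) \<le> real n"
      using nonneg by (intro always_eventually) (auto simp: indicator_def)
  qed measurable
  have mono: "mono (\<lambda>n. ?f n l)" for l
    using nonneg by (intro monoI) (auto simp: indicator_def)
  have "incseq (\<lambda>n. \<integral>l. ?f n l \<partial>M)"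
    using mono by (intro monoI integral_mono int) (auto dest: monoD)
  then obtain x where "(\<lambda>n. \<integral>l. ?f n l \<partial>M) \<longlonglongrightarrow> x"
    using incseq_convergent[of "\<lambda>n. \<integral>l. ?f n l \<partial>M" K] bound by blast
  moreover have "(\<lambda>n. ?f n l) \<longlonglongrightarrow> f l" for l
  proof (rule tendsto_eventually)
    have "f l \<le> real n" if "n \<ge> nat \<lceil>f l\<rceil>" for n using that by linarith
    thus "\<forall>\<^sub>F n in sequentially. ?f n l = f l"
      by (intro eventually_sequentiallyI[of "nat \<lceil>f l\<rceil>"]) simp
  qed
  ultimately show ?thesis
    using int mono by (intro integrable_monotone_convergence[of M ?f f x]) auto
qed

locale projection_measure = weighted_l2 \<mu> for \<mu> :: "'v \<Rightarrow> real" +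
  fixes E :: "real set \<Rightarrow> ('v \<Rightarrow> real) \<Rightarrow> ('v \<Rightarrow> real)"
  assumes pvm: "projection_valued_measure \<mu> E"
begin

lemma
  assumes B: "B \<in> sets borel" and u: "u \<in> l2 \<mu>"
  shows E_l2: "E B u \<in> l2 \<mu>"
    and E_idem: "E B (E B u) = E B u"
    and E_lincomb: "v \<in> l2 \<mu> \<Longrightarrow> E B (\<lambda>x. a * u x + b * v x) = (\<lambda>x. a * E B u x + b * E B v x)"
    and E_symmetric: "v \<in> l2 \<mu> \<Longrightarrow> l2_inner \<mu> (E B u) v = l2_inner \<mu> u (E B v)"
proof -
  have "orthogonal_projection \<mu> (E B)"
    using pvm B by (simp add: projection_valued_measure_def)
  with u show "E B u \<in> l2 \<mu>" "E B (E B u) = E B u"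
    "v \<in> l2 \<mu> \<Longrightarrow> E B (\<lambda>x. a * u x + b * v x) = (\<lambda>x. a * E B u x + b * E B v x)"
    "v \<in> l2 \<mu> \<Longrightarrow> l2_inner \<mu> (E B u) v = l2_inner \<mu> u (E B v)"
    unfolding orthogonal_projection_def by blast+
qed

lemma E_UNIV: "u \<in> l2 \<mu> \<Longrightarrow> E UNIV u = u"
  using pvm by (simp add: projection_valued_measure_def)

lemma E_inter: "B \<in> sets borel \<Longrightarrow> C \<in> sets borel \<Longrightarrow> u \<in> l2 \<mu> \<Longrightarrow> E (B \<inter> C) u = E B (E C u)"
  using pvm unfolding projection_valued_measure_def by blast

lemma E_sums:
  assumes "range B \<subseteq> sets borel" "disjoint_family B" "u \<in> l2 \<mu>" "v \<in> l2 \<mu>"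
  shows "(\<lambda>n::nat. l2_inner \<mu> (E (B n) u) v) sums l2_inner \<mu> (E (\<Union>n. B n) u) v"
  using pvm assms unfolding projection_valued_measure_def by blast

lemma E_empty: assumes "u \<in> l2 \<mu>" "v \<in> l2 \<mu>" shows "l2_inner \<mu> (E {} u) v = 0"
proof -
  have "(\<lambda>n::nat. l2_inner \<mu> (E {} u) v) sums l2_inner \<mu> (E {} u) v"
    using E_sums[of "\<lambda>_. {}" u v] assms by (simp add: disjoint_family_on_def)
  thus ?thesis using sums_summable summable_const_iff by blast
qed

lemma E_inner_nonneg:
  assumes "B \<in> sets borel" "u \<in> l2 \<mu>"
  shows "0 \<le> l2_inner \<mu> (E B u) u"
proof -
  have "l2_inner \<mu> (E B u) u = l2_inner \<mu> (E B u) (E B u)"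
    using E_symmetric[OF assms(1) E_l2[OF assms] assms(2)] E_idem[OF assms] by simp
  thus ?thesis using l2_inner_self_nonneg by simp
qed

abbreviation spectral_meas ("\<nu>") where "\<nu> \<equiv> spectral_dist \<mu> E"

abbreviation spectral_form ("\<S>") where "\<S> \<equiv> spectral_integral \<mu> E"

lemma sets_spectral_dist [simp, measurable_cong]: "sets (\<nu> u) = sets borel"
  unfolding spectral_dist_def by (metis sets.sigma_sets_eq sets_measure_of space_borel subset_UNIV
      sets.space_closed)

lemma space_spectral_dist [simp]: "space (\<nu> u) = UNIV"
  using sets_eq_imp_space_eq[OF sets_spectral_dist] by simp

lemma borel_measurable_spectral_dist: "f \<in> borel_measurable borel \<Longrightarrow> f \<in> borel_measurable (\<nu> u)"
  using measurable_cong_sets[OF sets_spectral_dist refl] by blast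

lemma emeasure_spectral_dist:
  assumes u: "u \<in> l2 \<mu>" and B: "B \<in> sets borel"
  shows "emeasure (\<nu> u) B = ennreal (l2_inner \<mu> (E B u) u)"
proof (rule emeasure_measure_of[OF spectral_dist_def])
  show "positive (sets (\<nu> u)) (\<lambda>B. ennreal (l2_inner \<mu> (E B u) u))"
    using E_empty[OF u u] by (simp add: positive_def)
  show "countably_additive (sets (\<nu> u)) (\<lambda>B. ennreal (l2_inner \<mu> (E B u) u))"
  proof (rule countably_additiveI)
    fix B :: "nat \<Rightarrow> real set"
    assume B: "range B \<subseteq> sets (\<nu> u)" "disjoint_family B"
    show "(\<Sum>i. ennreal (l2_inner \<mu> (E (B i) u) u)) = ennreal (l2_inner \<mu> (E (\<Union>i. B i) u) u)"
    proof (rule suminf_ennreal_eq)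
      show "0 \<le> l2_inner \<mu> (E (B i) u) u" for i
        using B u by (intro E_inner_nonneg) auto
      show "(\<lambda>i. l2_inner \<mu> (E (B i) u) u) sums l2_inner \<mu> (E (\<Union>i. B i) u) u"
        using B u by (intro E_sums) auto
    qed
  qed
qed (use B in auto)

lemma measure_spectral_dist:
  assumes "u \<in> l2 \<mu>" "B \<in> sets borel"
  shows "measure (\<nu> u) B = l2_inner \<mu> (E B u) u"
  using emeasure_spectral_dist[OF assms] E_inner_nonneg[OF assms(2,1)] by (simp add: measure_def)

lemma finite_measure_spectral_dist: "u \<in> l2 \<mu> \<Longrightarrow> finite_measure (\<nu> u)"
  by (intro finite_measureI) (simp add: emeasure_spectral_dist)

lemma integrable_spectral_dist:
  assumes "u \<in> l2 \<mu>" "bounded_borel g"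
  shows "integrable (\<nu> u) g"
proof -
  interpret finite_measure "\<nu> u" by (rule finite_measure_spectral_dist[OF assms(1)])
  obtain C where "\<And>l. \<bar>g l\<bar> \<le> C" using bounded_borel_bound[OF assms(2)] by blast
  thus ?thesis
    using borel_measurable_spectral_dist[OF bounded_borel_measurable[OF assms(2)]]
    by (intro integrable_const_bound[of g C]) auto
qed

lemma spectral_integral_bound:
  assumes u: "u \<in> l2 \<mu>" and g: "bounded_borel g" and C: "\<And>l. \<bar>g l\<bar> \<le> C"
  shows "\<bar>\<integral>l. g l \<partial>\<nu> u\<bar> \<le> C * l2_inner \<mu> u u"
proof -
  interpret finite_measure "\<nu> u" by (rule finite_measure_spectral_dist[OF u])
  have "\<bar>\<integral>l. g l \<partial>\<nu> u\<bar> \<le> (\<integral>l. \<bar>g l\<bar> \<partial>\<nu> u)" by (rule integral_abs_bound)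
  also have "\<dots> \<le> (\<integral>l. C \<partial>\<nu> u)"
    using integrable_spectral_dist[OF u g] C by (intro integral_mono) auto
  also have "\<dots> = C * l2_inner \<mu> u u"
    using measure_spectral_dist[OF u, of UNIV] E_UNIV[OF u] by simp
  finally show ?thesis .
qed

text \<open>On indicators the polarization formula gives back the bilinear form of the projection, because
  the projection is symmetric.\<close>

lemma spectral_integral_indicator:
  assumes B: "B \<in> sets borel" and u: "u \<in> l2 \<mu>" and v: "v \<in> l2 \<mu>"
  shows "\<S> (indicator B) u v = l2_inner \<mu> (E B u) v"
proof -
  have Eu: "E B u \<in> l2 \<mu>" and Ev: "E B v \<in> l2 \<mu>" using E_l2 B u v by auto
  have uv: "l2_inner \<mu> (E B v) u = l2_inner \<mu> (E B u) v"
    using E_symmetric[OF B u v] l2_inner_commute[of u "E B v"] by simp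
  have quad: "l2_inner \<mu> (E B (\<lambda>x. 1 * u x + s * v x)) (\<lambda>x. 1 * u x + s * v x) =
      l2_inner \<mu> (E B u) u + 2 * s * l2_inner \<mu> (E B u) v + s * s * l2_inner \<mu> (E B v) v" for s
    unfolding E_lincomb[OF B u v] l2_inner_lincomb[OF Eu Ev l2_lincomb[OF u v]]
      l2_inner_lincomb_right[OF u v Eu] l2_inner_lincomb_right[OF u v Ev] uv
    by (simp add: algebra_simps)
  have "measure (\<nu> (\<lambda>x. u x + v x)) B = l2_inner \<mu> (E B (\<lambda>x. u x + v x)) (\<lambda>x. u x + v x)"
    "measure (\<nu> (\<lambda>x. u x - v x)) B = l2_inner \<mu> (E B (\<lambda>x. u x - v x)) (\<lambda>x. u x - v x)"
    using measure_spectral_dist l2_add[OF u v] l2_diff[OF u v] B by auto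
  thus ?thesis
    using quad[of 1] quad[of "-1"] by (simp add: spectral_integral_def)
qed

lemma spectral_integral_lincomb_fun:
  assumes f: "bounded_borel f" and g: "bounded_borel g" and u: "u \<in> l2 \<mu>" and v: "v \<in> l2 \<mu>"
  shows "\<S> (\<lambda>l. a * f l + b * g l) u v = a * \<S> f u v + b * \<S> g u v"
proof -
  note i = integrable_spectral_dist[OF l2_add[OF u v]] integrable_spectral_dist[OF l2_diff[OF u v]]
  show ?thesis
    using i[OF f] i[OF g] by (simp add: spectral_integral_def field_simps)
qed

lemma spectral_integral_limit:
  assumes f: "\<And>n::nat. bounded_borel (f n)" and C: "\<And>n l. \<bar>f n l\<bar> \<le> C" and g: "bounded_borel g"
    and lim: "\<And>l. (\<lambda>n. f n l) \<longlonglongrightarrow> g l" and u: "u \<in> l2 \<mu>" and v: "v \<in> l2 \<mu>"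
  shows "(\<lambda>n. \<S> (f n) u v) \<longlonglongrightarrow> \<S> g u v"
proof -
  have "(\<lambda>n. \<integral>l. f n l \<partial>\<nu> z) \<longlonglongrightarrow> (\<integral>l. g l \<partial>\<nu> z)" if z: "z \<in> l2 \<mu>" for z
  proof (rule integral_dominated_convergence[where w = "\<lambda>_. C"])
    interpret finite_measure "\<nu> z" by (rule finite_measure_spectral_dist[OF z])
    show "integrable (\<nu> z) (\<lambda>_. C)" by simp
  qed (use lim C f g in \<open>auto intro!: borel_measurable_spectral_dist bounded_borel_measurable\<close>)
  from this[OF l2_add[OF u v]] this[OF l2_diff[OF u v]] show ?thesis
    unfolding spectral_integral_def by (intro tendsto_intros) auto
qed

lemma spectral_integral_lincomb:
  assumes g: "bounded_borel g" and u: "u \<in> l2 \<mu>" and u': "u' \<in> l2 \<mu>" and v: "v \<in> l2 \<mu>"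
  shows "\<S> g (\<lambda>x. a * u x + b * u' x) v = a * \<S> g u v + b * \<S> g u' v"
  using g
proof (induction g rule: bounded_borel_induct)
  case (indicator B)
  thus ?case
    using spectral_integral_indicator[OF indicator] u u' v
    by (simp add: l2_lincomb E_lincomb[OF indicator u u'] l2_inner_lincomb E_l2)
next
  case (lincomb f g c d)
  thus ?case
    using u u' v by (simp add: spectral_integral_lincomb_fun l2_lincomb algebra_simps)
next
  case (limit f g C)
  note lim = spectral_integral_limit[OF limit(1-4)]
  have "(\<lambda>n. \<S> (f n) (\<lambda>x. a * u x + b * u' x) v) \<longlonglongrightarrow> a * \<S> g u v + b * \<S> g u' v"
    unfolding limit(5) by (intro tendsto_intros lim u u' v)
  thus ?case using lim[OF l2_lincomb[OF u u'] v] LIMSEQ_unique by blast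
qed

lemma spectral_integral_commute:
  assumes g: "bounded_borel g" and u: "u \<in> l2 \<mu>" and v: "v \<in> l2 \<mu>"
  shows "\<S> g u v = \<S> g v u"
  using g
proof (induction g rule: bounded_borel_induct)
  case (indicator B)
  thus ?case
    using spectral_integral_indicator[OF indicator] u v E_symmetric[OF indicator u v]
      l2_inner_commute[of u "E B v"] by simp
next
  case (lincomb f g c d)
  thus ?case using u v by (simp add: spectral_integral_lincomb_fun)
next
  case (limit f g C)
  note lim = spectral_integral_limit[OF limit(1-4)]
  show ?case using lim[OF u v] lim[OF v u] limit(5) LIMSEQ_unique by simp
qed

lemma spectral_integral_self:
  assumes g: "bounded_borel g" and u: "u \<in> l2 \<mu>"
  shows "\<S> g u u = (\<integral>l. g l \<partial>\<nu> u)"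
  using g
proof (induction g rule: bounded_borel_induct)
  case (indicator B)
  thus ?case
    using spectral_integral_indicator[OF indicator u u] measure_spectral_dist[OF u indicator] by simp
next
  case (lincomb f g c d)
  thus ?case using u by (simp add: spectral_integral_lincomb_fun integrable_spectral_dist)
next
  case (limit f g C)
  have "(\<lambda>n. \<integral>l. f n l \<partial>\<nu> u) \<longlonglongrightarrow> (\<integral>l. g l \<partial>\<nu> u)"
  proof (rule integral_dominated_convergence[where w = "\<lambda>_. C"])
    interpret finite_measure "\<nu> u" by (rule finite_measure_spectral_dist[OF u])
    show "integrable (\<nu> u) (\<lambda>_. C)" by simp
  qed (use limit in \<open>auto intro!: borel_measurable_spectral_dist bounded_borel_measurable\<close>)
  thus ?case
    using spectral_integral_limit[OF limit(1-4) u u] limit(5) LIMSEQ_unique by simp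
qed

lemma spectral_integral_E:
  assumes g: "bounded_borel g" and B: "B \<in> sets borel" and u: "u \<in> l2 \<mu>" and v: "v \<in> l2 \<mu>"
  shows "\<S> g u (E B v) = \<S> (\<lambda>l. indicator B l * g l) u v"
  using g
proof (induction g rule: bounded_borel_induct)
  case (indicator C)
  have "l2_inner \<mu> (E C u) (E B v) = l2_inner \<mu> (E (B \<inter> C) u) v"
    using E_symmetric[OF B E_l2[OF indicator u] v] E_inter[OF B indicator u] by simp
  thus ?case
    using spectral_integral_indicator[OF indicator u E_l2[OF B v]]
      spectral_integral_indicator[OF sets.Int[OF B indicator] u v]
    by (simp add: indicator_inter_arith[abs_def])
next
  case (lincomb f g c d)
  have "\<S> (\<lambda>l. c * (indicator B l * f l) + d * (indicator B l * g l)) u v =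
      c * \<S> (\<lambda>l. indicator B l * f l) u v + d * \<S> (\<lambda>l. indicator B l * g l) u v"
    using lincomb B u v
    by (intro spectral_integral_lincomb_fun bounded_borel_mult bounded_borel_indicator)
  thus ?case
    using spectral_integral_lincomb_fun[OF lincomb(1,2) u E_l2[OF B v]] lincomb
    by (simp add: algebra_simps)
next
  case (limit f g C)
  have "(\<lambda>n. \<S> (\<lambda>l. indicator B l * f n l) u v) \<longlonglongrightarrow> \<S> (\<lambda>l. indicator B l * g l) u v"
  proof (rule spectral_integral_limit)
    show "\<bar>indicator B l * f n l\<bar> \<le> C" for n l
      using limit(2)[of n l] by (auto simp: indicator_def)
    show "(\<lambda>n. indicator B l * f n l) \<longlonglongrightarrow> indicator B l * g l" for l
      by (intro tendsto_intros limit)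
  qed (use limit B u v in \<open>auto intro: bounded_borel_mult bounded_borel_indicator\<close>)
  thus ?case
    using spectral_integral_limit[OF limit(1-4) u E_l2[OF B v]] limit(5) LIMSEQ_unique by simp
qed

text \<open>The operator \<open>\<integral> g dE\<close>, read off from its matrix coefficients against the point masses.\<close>

definition calculus :: "(real \<Rightarrow> real) \<Rightarrow> ('v \<Rightarrow> real) \<Rightarrow> ('v \<Rightarrow> real)" where
  "calculus g u = (\<lambda>x. \<S> g u (indicator {x}) / \<mu> x)"

lemma
  assumes g: "bounded_borel g" and u: "u \<in> l2 \<mu>"
  shows calculus_l2: "calculus g u \<in> l2 \<mu>"
    and calculus_inner: "v \<in> l2 \<mu> \<Longrightarrow> l2_inner \<mu> (calculus g u) v = \<S> g u v"
proof -
  obtain C where C: "0 \<le> C" "\<And>l. \<bar>g l\<bar> \<le> C" using bounded_borel_bound[OF g] by blast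
  have lin: "\<S> g u (\<lambda>x. a * v x + b * v' x) = a * \<S> g u v + b * \<S> g u v'"
    if "v \<in> l2 \<mu>" "v' \<in> l2 \<mu>" for a b v v'
    using spectral_integral_lincomb[OF g that u] spectral_integral_commute[OF g u] that
    by (simp add: l2_lincomb)
  \<comment> \<open>For a unit vector v, polarization and the parallelogram law bound the form by this constant;
    the dependence on u is immaterial, since u is fixed in the representation theorem.\<close>
  have "\<bar>\<S> g u v\<bar> \<le> (C * (l2_inner \<mu> u u + 1) / 2) * l2_norm \<mu> v" if v: "v \<in> l2 \<mu>" for v
  proof (cases "l2_inner \<mu> v v = 0")
    case True
    have "v = (\<lambda>x. 0 * v x + 0 * v x)" using l2_inner_self_eq_0[OF v True] by auto
    hence "\<S> g u v = 0" using lin[OF v v, of 0 0] by simp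
    thus ?thesis using True by (simp add: l2_norm_def)
  next
    case False
    define s where "s = l2_norm \<mu> v"
    have s: "s > 0" using False l2_inner_self_nonneg[of v] by (simp add: s_def l2_norm_def)
    define z where "z = (\<lambda>x. (1 / s) * v x)"
    have z: "z \<in> l2 \<mu>" unfolding z_def by (rule l2_scale[OF v])
    have vz: "v = (\<lambda>x. s * z x + 0 * z x)" using s by (simp add: z_def fun_eq_iff)
    have "l2_inner \<mu> z z = (1 / s) * ((1 / s) * l2_inner \<mu> v v)"
      using l2_inner_lincomb[OF v v z, of "1 / s" 0] l2_inner_lincomb_right[OF v v v, of "1 / s" 0]
      by (simp add: z_def)
    also have "\<dots> = 1" using s by (simp add: l2_norm_square[symmetric] s_def power2_eq_square)
    finally have zz: "l2_inner \<mu> z z = 1" .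
    have p: "l2_inner \<mu> (\<lambda>x. 1 * u x + t * z x) (\<lambda>x. 1 * u x + t * z x) =
        l2_inner \<mu> u u + 2 * t * l2_inner \<mu> u z + t * t" for t
      unfolding l2_inner_lincomb[OF u z l2_lincomb[OF u z]]
        l2_inner_lincomb_right[OF u z u] l2_inner_lincomb_right[OF u z z]
      using zz l2_inner_commute[of z u] by (simp add: algebra_simps)
    have "\<bar>\<S> g u z\<bar> \<le> (\<bar>\<integral>l. g l \<partial>\<nu> (\<lambda>x. u x + z x)\<bar> + \<bar>\<integral>l. g l \<partial>\<nu> (\<lambda>x. u x - z x)\<bar>) / 4"
      by (simp add: spectral_integral_def)
    also have "\<dots> \<le> (C * l2_inner \<mu> (\<lambda>x. u x + z x) (\<lambda>x. u x + z x)
        + C * l2_inner \<mu> (\<lambda>x. u x - z x) (\<lambda>x. u x - z x)) / 4"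
      using spectral_integral_bound[OF l2_add[OF u z] g C(2)]
        spectral_integral_bound[OF l2_diff[OF u z] g C(2)] by (intro divide_right_mono add_mono) auto
    also have "\<dots> = C * (l2_inner \<mu> u u + 1) / 2"
    proof -
      have "l2_inner \<mu> (\<lambda>x. u x + z x) (\<lambda>x. u x + z x)
          + l2_inner \<mu> (\<lambda>x. u x - z x) (\<lambda>x. u x - z x) = 2 * (l2_inner \<mu> u u + 1)"
        using p[of 1] p[of "-1"] by simp
      thus ?thesis by (simp only: distrib_left[symmetric])
    qed
    finally have "\<bar>\<S> g u z\<bar> \<le> C * (l2_inner \<mu> u u + 1) / 2" .
    hence "s * \<bar>\<S> g u z\<bar> \<le> s * (C * (l2_inner \<mu> u u + 1) / 2)" using s by (intro mult_left_mono) auto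
    moreover have "\<S> g u v = s * \<S> g u z" using lin[OF z z, of s 0] vz by simp
    ultimately show ?thesis using s by (simp add: abs_mult s_def[symmetric] mult.commute)
  qed
  note riesz = riesz_representation[of "\<S> g u", OF lin this]
  show "calculus g u \<in> l2 \<mu>" "v \<in> l2 \<mu> \<Longrightarrow> l2_inner \<mu> (calculus g u) v = \<S> g u v"
    unfolding calculus_def using riesz by blast+
qed

lemma spectral_integral_calculus:
  assumes f: "bounded_borel f" and g: "bounded_borel g" and u: "u \<in> l2 \<mu>" and v: "v \<in> l2 \<mu>"
  shows "\<S> f (calculus g u) v = \<S> (\<lambda>l. f l * g l) u v"
  using f
proof (induction f rule: bounded_borel_induct)
  case (indicator B)
  have "\<S> (indicator B) (calculus g u) v = l2_inner \<mu> (calculus g u) (E B v)"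
    using spectral_integral_indicator[OF indicator calculus_l2[OF g u] v]
      E_symmetric[OF indicator calculus_l2[OF g u] v] by simp
  thus ?case
    using calculus_inner[OF g u E_l2[OF indicator v]] spectral_integral_E[OF g indicator u v] by simp
next
  case (lincomb f h c d)
  have "\<S> (\<lambda>l. c * (f l * g l) + d * (h l * g l)) u v =
      c * \<S> (\<lambda>l. f l * g l) u v + d * \<S> (\<lambda>l. h l * g l) u v"
    using lincomb g u v by (intro spectral_integral_lincomb_fun bounded_borel_mult)
  thus ?case
    using spectral_integral_lincomb_fun[OF lincomb(1,2) calculus_l2[OF g u] v] lincomb
    by (simp add: algebra_simps)
next
  case (limit f h C)
  obtain D where D: "0 \<le> D" "\<And>l. \<bar>g l\<bar> \<le> D" using bounded_borel_bound[OF g] by blast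
  have "(\<lambda>n. \<S> (\<lambda>l. f n l * g l) u v) \<longlonglongrightarrow> \<S> (\<lambda>l. h l * g l) u v"
  proof (rule spectral_integral_limit)
    show "\<bar>f n l * g l\<bar> \<le> C * D" for n l
      using limit(2)[of n l] D by (simp add: abs_mult mult_mono')
    show "(\<lambda>n. f n l * g l) \<longlonglongrightarrow> h l * g l" for l
      by (intro tendsto_intros limit)
  qed (use limit g u v in \<open>auto intro: bounded_borel_mult\<close>)
  thus ?case
    using spectral_integral_limit[OF limit(1-4) calculus_l2[OF g u] v] limit(5) LIMSEQ_unique
    by simp
qed

lemma calculus_mult:
  assumes f: "bounded_borel f" and g: "bounded_borel g" and u: "u \<in> l2 \<mu>"
  shows "calculus f (calculus g u) = calculus (\<lambda>l. f l * g l) u"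
  using spectral_integral_calculus[OF f g u indicator_in_l2] by (simp add: calculus_def)

text \<open>With \<open>A = \<integral> \<lambda> dE\<close>, moving one factor \<open>g(A)\<close> across the inner product shows that the spectral
  measure of \<open>g(A)u\<close> has density \<open>g\<^sup>2\<close> with respect to that of \<open>u\<close>.\<close>

lemma integral_spectral_dist_calculus:
  assumes f: "bounded_borel f" and g: "bounded_borel g" and u: "u \<in> l2 \<mu>"
  shows "(\<integral>l. f l \<partial>\<nu> (calculus g u)) = (\<integral>l. f l * (g l)\<^sup>2 \<partial>\<nu> u)"
proof -
  have fg: "bounded_borel (\<lambda>l. f l * g l)" by (intro bounded_borel_mult f g)
  note z = calculus_l2[OF g u]
  have "(\<integral>l. f l \<partial>\<nu> (calculus g u)) = \<S> f (calculus g u) (calculus g u)"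
    by (rule spectral_integral_self[OF f z, symmetric])
  also have "\<dots> = \<S> (\<lambda>l. f l * g l) (calculus g u) u"
    using spectral_integral_calculus[OF f g u z] spectral_integral_commute[OF fg u z] by simp
  also have "\<dots> = \<S> (\<lambda>l. f l * g l * g l) u u"
    by (rule spectral_integral_calculus[OF fg g u u])
  also have "\<dots> = (\<integral>l. f l * g l * g l \<partial>\<nu> u)"
    by (rule spectral_integral_self[OF bounded_borel_mult[OF fg g] u])
  finally show ?thesis by (simp add: power2_eq_square mult.assoc)
qed

text \<open>This bounds the spectral measures of \<open>u + v\<close> and \<open>u - v\<close> by those of \<open>u\<close> and \<open>v\<close>, and so shows
  that the domain of an unbounded function of the operator is closed under sums and differences.\<close>

lemma parallelogram_spectral_dist:
  assumes f: "bounded_borel f" and u: "u \<in> l2 \<mu>" and v: "v \<in> l2 \<mu>"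
  shows "(\<integral>l. f l \<partial>\<nu> (\<lambda>x. u x + v x)) + (\<integral>l. f l \<partial>\<nu> (\<lambda>x. u x - v x)) =
    2 * (\<integral>l. f l \<partial>\<nu> u) + 2 * (\<integral>l. f l \<partial>\<nu> v)"
proof -
  have "(\<integral>l. f l \<partial>\<nu> (\<lambda>x. 1 * u x + s * v x)) = \<S> f u u + 2 * s * \<S> f u v + s * s * \<S> f v v" for s
  proof -
    let ?w = "\<lambda>x. 1 * u x + s * v x"
    have w: "?w \<in> l2 \<mu>" by (rule l2_lincomb[OF u v])
    have "(\<integral>l. f l \<partial>\<nu> ?w) = 1 * \<S> f u ?w + s * \<S> f v ?w"
      using spectral_integral_self[OF f w] spectral_integral_lincomb[OF f u v w, of 1 s] by simp
    moreover have "\<S> f u ?w = 1 * \<S> f u u + s * \<S> f v u"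
      using spectral_integral_lincomb[OF f u v u, of 1 s] spectral_integral_commute[OF f u w] by simp
    moreover have "\<S> f v ?w = 1 * \<S> f u v + s * \<S> f v v"
      using spectral_integral_lincomb[OF f u v v, of 1 s] spectral_integral_commute[OF f v w] by simp
    ultimately show ?thesis
      using spectral_integral_commute[OF f v u] by (simp add: algebra_simps)
  qed
  from this[of 1] this[of "-1"] show ?thesis
    using spectral_integral_self[OF f] u v by simp
qed

lemma bounded_borel_truncation:
  assumes "h \<in> borel_measurable borel" "\<And>l. 0 \<le> h l"
  shows "bounded_borel (\<lambda>l. h l * indicator {l. h l \<le> real n} l)"
proof (rule bounded_borelI)
  show "\<bar>h l * indicator {l. h l \<le> real n} l\<bar> \<le> real n" for l
    using assms(2)[of l] by (auto simp: indicator_def)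
  show "(\<lambda>l. h l * indicator {l. h l \<le> real n} l) \<in> borel_measurable borel"
    using assms(1) by measurable
qed

lemma spectral_domain_add_diff:
  assumes h: "h \<in> borel_measurable borel" and u: "u \<in> spectral_domain \<mu> E h"
    and v: "v \<in> spectral_domain \<mu> E h"
  shows "(\<lambda>x. u x + v x) \<in> spectral_domain \<mu> E h" "(\<lambda>x. u x - v x) \<in> spectral_domain \<mu> E h"
proof -
  have u2: "u \<in> l2 \<mu>" and v2: "v \<in> l2 \<mu>" using u v by (auto simp: spectral_domain_def)
  have iu: "integrable (\<nu> u) (\<lambda>l. (h l)\<^sup>2)" and iv: "integrable (\<nu> v) (\<lambda>l. (h l)\<^sup>2)"
    using u v by (auto simp: spectral_domain_def)
  let ?t = "\<lambda>n l. (h l)\<^sup>2 * indicator {l. (h l)\<^sup>2 \<le> real n} l"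
  have m: "(\<lambda>l. (h l)\<^sup>2) \<in> borel_measurable borel" using h by measurable
  have t: "bounded_borel (?t n)" for n by (intro bounded_borel_truncation m) simp
  have le: "(\<integral>l. ?t n l \<partial>\<nu> z) \<le> (\<integral>l. (h l)\<^sup>2 \<partial>\<nu> z)"
    if "z \<in> l2 \<mu>" "integrable (\<nu> z) (\<lambda>l. (h l)\<^sup>2)" for z n
    by (intro integral_mono integrable_spectral_dist t that) (auto simp: indicator_def)
  have nn: "0 \<le> (\<integral>l. ?t n l \<partial>\<nu> z)" for z n by (intro integral_nonneg_AE) auto
  let ?K = "2 * (\<integral>l. (h l)\<^sup>2 \<partial>\<nu> u) + 2 * (\<integral>l. (h l)\<^sup>2 \<partial>\<nu> v)"
  have "(\<integral>l. ?t n l \<partial>\<nu> (\<lambda>x. u x + v x)) \<le> ?K" "(\<integral>l. ?t n l \<partial>\<nu> (\<lambda>x. u x - v x)) \<le> ?K" for n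
    using parallelogram_spectral_dist[OF t[of n] u2 v2] le[OF u2 iu, of n] le[OF v2 iv, of n]
      nn[of "\<lambda>x. u x + v x" n] nn[of "\<lambda>x. u x - v x" n] by linarith+
  thus "(\<lambda>x. u x + v x) \<in> spectral_domain \<mu> E h" "(\<lambda>x. u x - v x) \<in> spectral_domain \<mu> E h"
    using m u2 v2 unfolding spectral_domain_def
    by (auto intro!: integrable_from_truncations finite_measure_spectral_dist l2_add l2_diff)
qed

lemma spectral_domain_integrable:
  assumes h: "h \<in> borel_measurable borel" and u: "u \<in> spectral_domain \<mu> E h"
  shows "integrable (\<nu> u) h"
proof -
  interpret finite_measure "\<nu> u"
    using u by (intro finite_measure_spectral_dist) (simp add: spectral_domain_def)
  have "integrable (\<nu> u) (\<lambda>l. 1 + (h l)\<^sup>2)" using u by (simp add: spectral_domain_def)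
  thus ?thesis
  proof (rule Bochner_Integration.integrable_bound)
    have "\<bar>h l\<bar> \<le> 1 + (h l)\<^sup>2" for l
      by (rule abs_le_one_plus_square)
    thus "AE l in \<nu> u. norm (h l) \<le> norm (1 + (h l)\<^sup>2)" by simp
  qed (rule borel_measurable_spectral_dist[OF h])
qed

lemma spectral_integral_dominated:
  assumes h: "h \<in> borel_measurable borel" and u: "u \<in> spectral_domain \<mu> E h"
    and v: "v \<in> spectral_domain \<mu> E h"
    and f: "\<And>n::nat. f n \<in> borel_measurable borel" and g: "g \<in> borel_measurable borel"
    and bound: "\<And>n l. \<bar>f n l\<bar> \<le> \<bar>h l\<bar>" and lim: "\<And>l. (\<lambda>n. f n l) \<longlonglongrightarrow> g l"
  shows "(\<lambda>n. \<S> (f n) u v) \<longlonglongrightarrow> \<S> g u v"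
proof -
  have "(\<lambda>n. \<integral>l. f n l \<partial>\<nu> z) \<longlonglongrightarrow> (\<integral>l. g l \<partial>\<nu> z)" if z: "z \<in> spectral_domain \<mu> E h" for z
    by (rule integral_dominated_convergence[where w = "\<lambda>l. \<bar>h l\<bar>"])
       (use lim bound f g spectral_domain_integrable[OF h z] in
         \<open>auto intro!: borel_measurable_spectral_dist\<close>)
  from this[OF spectral_domain_add_diff(1)[OF h u v]] this[OF spectral_domain_add_diff(2)[OF h u v]]
  show ?thesis
    unfolding spectral_integral_def by (intro tendsto_intros) auto
qed

text \<open>The link between the bounded calculus and the unbounded operator \<open>h(A)\<close>: if both \<open>g\<close> and \<open>h g\<close> are
  bounded, then \<open>g(A)u\<close> lies in the domain of \<open>h(A)\<close>, with \<open>h(A) g(A) u = (h g)(A) u\<close>. This is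
  multiplicativity for the truncations of \<open>h\<close>, followed by dominated convergence on both sides.\<close>

lemma calculus_in_functional_calculus:
  assumes h: "h \<in> borel_measurable borel" and g: "bounded_borel g"
    and hg: "bounded_borel (\<lambda>l. h l * g l)" and u: "u \<in> l2 \<mu>"
  shows "(calculus g u, calculus (\<lambda>l. h l * g l) u) \<in> functional_calculus \<mu> E h"
proof -
  let ?z = "calculus g u"
  have z: "?z \<in> l2 \<mu>" by (rule calculus_l2[OF g u])
  obtain C where C: "0 \<le> C" "\<And>l. \<bar>h l * g l\<bar> \<le> C" using bounded_borel_bound[OF hg] by blast
  have m: "(\<lambda>l. (h l)\<^sup>2) \<in> borel_measurable borel" using h by measurable
  have dom: "?z \<in> spectral_domain \<mu> E h"
    unfolding spectral_domain_def
  proof (intro CollectI conjI z, rule integrable_from_truncations[OF _ _ m])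
    fix n :: nat
    let ?t = "\<lambda>l. (h l)\<^sup>2 * indicator {l. (h l)\<^sup>2 \<le> real n} l"
    have t: "bounded_borel ?t" by (intro bounded_borel_truncation m) simp
    have "(\<integral>l. ?t l \<partial>\<nu> ?z) = (\<integral>l. ?t l * (g l)\<^sup>2 \<partial>\<nu> u)"
      by (rule integral_spectral_dist_calculus[OF t g u])
    also have "\<dots> \<le> C\<^sup>2 * l2_inner \<mu> u u"
    proof (rule order_trans[OF abs_ge_self spectral_integral_bound[OF u]])
      show "bounded_borel (\<lambda>l. ?t l * (g l)\<^sup>2)"
        using bounded_borel_mult[OF bounded_borel_mult[OF t g] g]
        by (simp add: power2_eq_square mult.assoc)
      show "\<bar>?t l * (g l)\<^sup>2\<bar> \<le> C\<^sup>2" for l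
        using power_mono[OF C(2)[of l], of 2]
        by (auto simp: indicator_def power_mult_distrib abs_mult)
    qed
    finally show "(\<integral>l. ?t l \<partial>\<nu> ?z) \<le> C\<^sup>2 * l2_inner \<mu> u u" .
  qed (use finite_measure_spectral_dist[OF z] in auto)
  have "l2_inner \<mu> (calculus (\<lambda>l. h l * g l) u) v = \<S> h ?z v" if v: "v \<in> spectral_domain \<mu> E h" for v
  proof -
    have v2: "v \<in> l2 \<mu>" using v by (simp add: spectral_domain_def)
    let ?t = "\<lambda>(n::nat) l. h l * indicator {l. \<bar>h l\<bar> \<le> real n} l"
    have mt: "?t n \<in> borel_measurable borel" for n using h by measurable
    have t: "bounded_borel (?t n)" for n
      by (rule bounded_borelI[OF mt, of _ "real n"]) (auto simp: indicator_def)
    have tlim: "(\<lambda>n. ?t n l) \<longlonglongrightarrow> h l" for l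
    proof (rule tendsto_eventually)
      have "\<bar>h l\<bar> \<le> real n" if "n \<ge> nat \<lceil>\<bar>h l\<bar>\<rceil>" for n using that by linarith
      thus "\<forall>\<^sub>F n in sequentially. ?t n l = h l"
        by (intro eventually_sequentiallyI[of "nat \<lceil>\<bar>h l\<bar>\<rceil>"]) simp
    qed
    have lim: "(\<lambda>n. \<S> (?t n) ?z v) \<longlonglongrightarrow> \<S> h ?z v"
      by (rule spectral_integral_dominated[OF h dom v mt h _ tlim]) (auto simp: indicator_def)
    have "(\<lambda>n. \<S> (?t n) ?z v) \<longlonglongrightarrow> \<S> (\<lambda>l. h l * g l) u v"
      unfolding spectral_integral_calculus[OF t g u v2]
    proof (rule spectral_integral_limit[OF _ _ hg _ u v2])
      show "bounded_borel (\<lambda>l. ?t n l * g l)" for n by (rule bounded_borel_mult[OF t g])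
      show "\<bar>?t n l * g l\<bar> \<le> C" for n l
        using C(1) C(2)[of l] by (auto simp: indicator_def)
      show "(\<lambda>n. ?t n l * g l) \<longlonglongrightarrow> h l * g l" for l by (intro tendsto_intros tlim)
    qed
    from LIMSEQ_unique[OF this lim] show ?thesis using calculus_inner[OF hg u v2] by simp
  qed
  thus ?thesis
    using dom calculus_l2[OF hg u] by (simp add: functional_calculus_def)
qed

lemma calculus_lincomb_fun:
  assumes "bounded_borel f" "bounded_borel g" "u \<in> l2 \<mu>"
  shows "calculus (\<lambda>l. a * f l + b * g l) u x = a * calculus f u x + b * calculus g u x"
  using spectral_integral_lincomb_fun[OF assms indicator_in_l2] by (simp add: calculus_def add_divide_distrib)

lemma calculus_one: 
  assumes u: "u \<in> l2 \<mu>"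
  shows "calculus (\<lambda>_. 1) u = u"
proof
  fix x
  have "calculus (\<lambda>_. 1) u x * \<mu> x = l2_inner \<mu> (E UNIV u) (indicator {x})"
    using spectral_integral_indicator[of UNIV u "indicator {x}"] u indicator_in_l2 measure_pos[of x]
    by (simp add: calculus_def)
  thus "calculus (\<lambda>_. 1) u x = u x"
    using E_UNIV[OF u] measure_pos[of x] by (simp add: l2_inner_indicator)
qed

lemma spectral_integral_cong_AE:
  assumes "f \<in> borel_measurable borel" "g \<in> borel_measurable borel"
    and "\<And>z. z \<in> l2 \<mu> \<Longrightarrow> AE l in \<nu> z. f l = g l" and "u \<in> l2 \<mu>" "v \<in> l2 \<mu>"
  shows "\<S> f u v = \<S> g u v"
proof -
  have "(\<integral>l. f l \<partial>\<nu> z) = (\<integral>l. g l \<partial>\<nu> z)" if "z \<in> l2 \<mu>" for z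
    using assms that by (intro integral_cong_AE) (auto intro: borel_measurable_spectral_dist)
  thus ?thesis
    using assms(4,5) l2_add l2_diff by (simp add: spectral_integral_def)
qed

end

section \<open>Dirichlet form, maximum principle and spectrum\<close>

context weighted_graph
begin

sublocale weighted_l2 \<mu>
  by unfold_locales (rule measure_pos)

text \<open>Green's formula for a finitely supported \<open>u\<close>: the form is
  \<open>- 1/2 (\<Sum>x y. w(x,y) (u(x) - u(y)) (v(x) - v(y)))\<close>, where the pairs with exactly one vertex in
  the support contribute the terms \<open>- k(x) u(x) v(x)\<close>, with \<open>k(x)\<close> the total weight of the edges from \<open>x\<close> out
  of the support. The hypotheses on \<open>v\<close> hold for \<open>v = u\<close> and for the negative part \<open>v = min u 0\<close>,
  which are the two uses.\<close>

lemma laplacian_form_nonpos: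
  assumes u: "u \<in> finsupp" and supp: "\<And>x. u x = 0 \<Longrightarrow> v x = 0"
    and mono: "\<And>x y. 0 \<le> (u x - u y) * (v x - v y)" and sgn: "\<And>x. 0 \<le> u x * v x"
  shows "l2_inner \<mu> (laplacian \<mu> w u) v \<le> 0"
proof -
  define F where "F = {x. u x \<noteq> 0}"
  have F: "finite F" using u by (simp add: F_def finsupp_def)
  define k where "k x = (\<Sum>\<^sub>\<infinity>y\<in>-F. w x y)" for x
  have k: "0 \<le> k x" for x unfolding k_def by (intro infsum_nonneg weight_nonneg)
  have lap: "laplacian \<mu> w u x * \<mu> x = (\<Sum>y\<in>F. w x y * (u y - u x)) - k x * u x" for x
  proof -
    have s: "(\<lambda>y. w x y) summable_on -F" by (rule summable_on_subset_banach[OF weight_summable]) simp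
    have "(\<Sum>\<^sub>\<infinity>y\<in>-F. w x y * (u y - u x)) = (\<Sum>\<^sub>\<infinity>y\<in>-F. w x y * (- u x))"
      by (intro infsum_cong) (simp add: F_def)
    also have "\<dots> = - (k x * u x)"
      unfolding k_def by (subst infsum_cmult_left[OF s]) simp
    finally have 1: "(\<Sum>\<^sub>\<infinity>y\<in>-F. w x y * (u y - u x)) = - (k x * u x)" .
    have "(\<lambda>y. w x y * (- u x)) summable_on -F" by (intro summable_on_cmult_left s)
    hence "(\<lambda>y. w x y * (u y - u x)) summable_on -F"
      by (rule summable_on_cong[THEN iffD1, rotated]) (simp add: F_def)
    hence "(\<Sum>\<^sub>\<infinity>y\<in>F \<union> -F. w x y * (u y - u x)) =
        (\<Sum>y\<in>F. w x y * (u y - u x)) + (\<Sum>\<^sub>\<infinity>y\<in>-F. w x y * (u y - u x))"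
      using F by (subst infsum_Un_disjoint) auto
    thus ?thesis using 1 measure_pos[of x] by (simp add: laplacian_def)
  qed
  define T where "T = (\<Sum>x\<in>F. \<Sum>y\<in>F. w x y * (u y - u x) * v x)"
  have "l2_inner \<mu> (laplacian \<mu> w u) v = (\<Sum>\<^sub>\<infinity>x\<in>F. laplacian \<mu> w u x * v x * \<mu> x)"
    unfolding l2_inner_def using supp by (intro infsum_cong_neutral) (auto simp: F_def)
  also have "\<dots> = (\<Sum>x\<in>F. (laplacian \<mu> w u x * \<mu> x) * v x)"
    using F by (simp add: mult_ac)
  also have "\<dots> = T - (\<Sum>x\<in>F. k x * (u x * v x))"
    unfolding lap T_def left_diff_distrib sum_subtractf sum_distrib_right by (simp add: mult_ac)
  also have "\<dots> \<le> T" using k sgn by (simp add: sum_nonneg)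
  also have "T \<le> 0"
  proof -
    have "T = (\<Sum>x\<in>F. \<Sum>y\<in>F. w y x * (u x - u y) * v y)" unfolding T_def by (rule sum.swap)
    hence "2 * T = (\<Sum>x\<in>F. \<Sum>y\<in>F. w x y * (u y - u x) * v x + w y x * (u x - u y) * v y)"
      unfolding sum.distrib using T_def by simp
    also have "\<dots> = (\<Sum>x\<in>F. \<Sum>y\<in>F. - (w x y * ((u x - u y) * (v x - v y))))"
      by (intro sum.cong refl) (simp add: weight_sym[of _ "_ :: 'v"] algebra_simps)
    also have "\<dots> \<le> 0" by (intro sum_nonpos) (simp add: weight_nonneg mono)
    finally show ?thesis by simp
  qed
  finally show ?thesis .
qed

lemma laplacian_indicator:
  assumes "x \<noteq> y"
  shows "laplacian \<mu> w (indicator {y}) x * \<mu> x = w x y"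
proof -
  have "(\<Sum>\<^sub>\<infinity>z. w x z * (indicator {y} z - indicator {y} x)) = (\<Sum>\<^sub>\<infinity>z\<in>{y}. w x z)"
    using assms by (intro infsum_cong_neutral) (auto simp: indicator_def)
  thus ?thesis using measure_pos[of x] by (simp add: laplacian_def)
qed

end

locale heat_graph = weighted_graph \<mu> w + projection_measure \<mu> E
  for \<mu> :: "'v \<Rightarrow> real" and w E +
  assumes laplacian_l2: "\<And>u. u \<in> finsupp \<Longrightarrow> laplacian \<mu> w u \<in> l2 \<mu>"
    and spectral: "op_minus (laplacian_op \<mu> w) = functional_calculus \<mu> E (\<lambda>l. l)"
begin

lemma laplacian_op_core:
  assumes "(u, f) \<in> laplacian_op \<mu> w"
  obtains s where "u \<in> l2 \<mu>" "f \<in> l2 \<mu>" "\<And>n::nat. s n \<in> finsupp"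
    "(\<lambda>n. l2_norm \<mu> (\<lambda>x. s n x - u x)) \<longlonglongrightarrow> 0"
    "(\<lambda>n. l2_norm \<mu> (\<lambda>x. laplacian \<mu> w (s n) x - f x)) \<longlonglongrightarrow> 0"
proof -
  obtain s g where *: "u \<in> l2 \<mu>" "f \<in> l2 \<mu>" "\<And>n::nat. (s n, g n) \<in> laplacian_finsupp \<mu> w"
    "(\<lambda>n. l2_norm \<mu> (\<lambda>x. s n x - u x)) \<longlonglongrightarrow> 0" "(\<lambda>n. l2_norm \<mu> (\<lambda>x. g n x - f x)) \<longlonglongrightarrow> 0"
    using assms unfolding laplacian_op_def op_closure_def by blast
  have "s n \<in> finsupp" "g n = laplacian \<mu> w (s n)" for n
    using *(3)[of n] by (auto simp: laplacian_finsupp_def)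
  with * show ?thesis by (intro that) auto
qed

lemma laplacian_op_nonpos:
  assumes "(u, f) \<in> laplacian_op \<mu> w"
  shows "l2_inner \<mu> f u \<le> 0"
proof -
  obtain s where s: "u \<in> l2 \<mu>" "f \<in> l2 \<mu>" "\<And>n::nat. s n \<in> finsupp"
    "(\<lambda>n. l2_norm \<mu> (\<lambda>x. s n x - u x)) \<longlonglongrightarrow> 0"
    "(\<lambda>n. l2_norm \<mu> (\<lambda>x. laplacian \<mu> w (s n) x - f x)) \<longlonglongrightarrow> 0"
    using laplacian_op_core[OF assms] by blast
  have "(\<lambda>n. l2_inner \<mu> (laplacian \<mu> w (s n)) (s n)) \<longlonglongrightarrow> l2_inner \<mu> f u"
    using s by (intro l2_inner_tendsto) (auto intro: laplacian_l2 finsupp_in_l2)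
  moreover have "l2_inner \<mu> (laplacian \<mu> w (s n)) (s n) \<le> 0" for n
    by (rule laplacian_form_nonpos[OF s(3)]) auto
  ultimately show ?thesis by (intro LIMSEQ_le_const2) auto
qed

text \<open>Testing with the negative part \<open>N = min u 0\<close> gives
  \<open>0 \<ge> \<langle>u - s \<Delta>u, N\<rangle> = \<parallel>N\<parallel>\<^sup>2 - s \<langle>\<Delta>u, N\<rangle> \<ge> \<parallel>N\<parallel>\<^sup>2\<close>. The sign of \<open>\<langle>\<Delta>u, N\<rangle>\<close> is known for finitely
  supported functions and persists in the limit because taking negative parts is a contraction.\<close>

lemma maximum_principle:
  assumes uf: "(u, f) \<in> laplacian_op \<mu> w" and s: "0 \<le> s" and nonneg: "\<And>x. 0 \<le> u x - s * f x"
  shows "0 \<le> u x"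
proof -
  obtain a where a: "u \<in> l2 \<mu>" "f \<in> l2 \<mu>" "\<And>n::nat. a n \<in> finsupp"
    "(\<lambda>n. l2_norm \<mu> (\<lambda>x. a n x - u x)) \<longlonglongrightarrow> 0"
    "(\<lambda>n. l2_norm \<mu> (\<lambda>x. laplacian \<mu> w (a n) x - f x)) \<longlonglongrightarrow> 0"
    using laplacian_op_core[OF uf] by blast
  define N where "N = (\<lambda>(u :: 'v \<Rightarrow> real) x. min (u x) 0)"
  have N: "N u \<in> l2 \<mu>" if "u \<in> l2 \<mu>" for u
    by (rule l2_dominated[OF that]) (auto simp: N_def)
  have "(\<lambda>n. l2_norm \<mu> (\<lambda>x. N (a n) x - N u x)) \<longlonglongrightarrow> 0"
  proof (rule Lim_null_comparison[OF always_eventually[OF allI] a(4)])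
    show "norm (l2_norm \<mu> (\<lambda>x. N (a n) x - N u x)) \<le> l2_norm \<mu> (\<lambda>x. a n x - u x)" for n
    proof -
      have "l2_norm \<mu> (\<lambda>x. N (a n) x - N u x) \<le> l2_norm \<mu> (\<lambda>x. a n x - u x)"
        by (rule l2_norm_mono[OF l2_diff[OF finsupp_in_l2[OF a(3)] a(1)]]) (auto simp: N_def)
      thus ?thesis using l2_norm_nonneg by simp
    qed
  qed
  hence "(\<lambda>n. l2_inner \<mu> (laplacian \<mu> w (a n)) (N (a n))) \<longlonglongrightarrow> l2_inner \<mu> f (N u)"
    using a by (intro l2_inner_tendsto) (auto intro: laplacian_l2 finsupp_in_l2 N)
  moreover have "l2_inner \<mu> (laplacian \<mu> w (a n)) (N (a n)) \<le> 0" for n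
    by (rule laplacian_form_nonpos[OF a(3)])
       (auto simp: N_def min_def mult_nonneg_nonneg mult_nonpos_nonpos zero_le_mult_iff)
  ultimately have "l2_inner \<mu> f (N u) \<le> 0" by (intro LIMSEQ_le_const2) auto
  hence "s * l2_inner \<mu> f (N u) \<le> 0" using s by (simp add: mult_le_0_iff)
  moreover have "l2_inner \<mu> u (N u) = l2_inner \<mu> (N u) (N u)"
    unfolding l2_inner_def by (intro infsum_cong) (simp add: N_def min_def)
  moreover have "l2_inner \<mu> (\<lambda>x. 1 * u x + (- s) * f x) (N u) \<le> 0"
  proof -
    have "0 \<le> (\<Sum>\<^sub>\<infinity>x. (u x - s * f x) * (- N u x) * \<mu> x)"
      using nonneg measure_pos by (intro infsum_nonneg mult_nonneg_nonneg) (auto simp: N_def less_imp_le)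
    thus ?thesis by (simp add: l2_inner_def infsum_uminus)
  qed
  ultimately have "l2_inner \<mu> (N u) (N u) = 0"
    using l2_inner_lincomb[OF a(1,2) N[OF a(1)], of 1 "- s"] l2_inner_self_nonneg[of "N u"] by simp
  hence "N u x = 0" by (rule l2_inner_self_eq_0[OF N[OF a(1)]])
  thus ?thesis by (simp add: N_def min_def split: if_splits)
qed

lemma laplacian_op_iff: "(u, f) \<in> laplacian_op \<mu> w \<longleftrightarrow> (u, \<lambda>x. - f x) \<in> functional_calculus \<mu> E (\<lambda>l. l)"
proof -
  have "(u, f) \<in> laplacian_op \<mu> w \<longleftrightarrow> (u, \<lambda>x. - f x) \<in> op_minus (laplacian_op \<mu> w)"
  proof
    assume "(u, \<lambda>x. - f x) \<in> op_minus (laplacian_op \<mu> w)"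
    then obtain g where g: "(u, g) \<in> laplacian_op \<mu> w" "(\<lambda>x. - f x) = (\<lambda>x. - g x)"
      by (auto simp: op_minus_def)
    have "f = g" using g(2) by (simp add: fun_eq_iff)
    thus "(u, f) \<in> laplacian_op \<mu> w" using g by simp
  qed (auto simp: op_minus_def)
  thus ?thesis by (simp add: spectral)
qed

lemma calculus_laplacian:
  assumes "bounded_borel g" "bounded_borel (\<lambda>l. l * g l)" "u \<in> l2 \<mu>"
  shows "(calculus g u, \<lambda>x. - calculus (\<lambda>l. l * g l) u x) \<in> laplacian_op \<mu> w"
  unfolding laplacian_op_iff using calculus_in_functional_calculus[of "\<lambda>l. l" g u] assms by simp

text \<open>If the spectral measure of \<open>u\<close> charged the negative half line, a vector \<open>z = g(-\<Delta>)u\<close> with \<open>g\<close>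
  supported there would satisfy \<open>\<langle>-\<Delta>z, z\<rangle> < 0\<close>. The factor \<open>1/(1 + \<lambda>\<^sup>2)\<close> makes both \<open>g\<close> and
  \<open>\<lambda> g(\<lambda>)\<close> bounded.\<close>

lemma spectrum_nonneg:
  assumes u: "u \<in> l2 \<mu>"
  shows "AE l in \<nu> u. 0 \<le> l"
proof -
  define g where "g = (\<lambda>l::real. indicator {..<0} l / (1 + l\<^sup>2))"
  have gm: "g \<in> borel_measurable borel" unfolding g_def by measurable
  have pos: "1 + l\<^sup>2 > 0" for l :: real by (simp add: add_pos_nonneg)
  have g: "bounded_borel g"
    by (rule bounded_borelI[OF gm, of 1]) (use pos in \<open>auto simp: g_def indicator_def\<close>)
  have "bounded_borel (\<lambda>l. l * g l)"
  proof (rule bounded_borelI[of _ 1])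
    show "\<bar>l * g l\<bar> \<le> 1" for l
    proof -
      have "\<bar>l\<bar> \<le> 1 + l\<^sup>2" by (rule abs_le_one_plus_square)
      thus ?thesis using pos[of l] by (auto simp: g_def indicator_def abs_mult divide_simps)
    qed
  qed (use gm in measurable)
  note lg = this
  let ?z = "calculus g u"
  have z: "?z \<in> l2 \<mu>" by (rule calculus_l2[OF g u])
  have "l2_inner \<mu> (\<lambda>x. - calculus (\<lambda>l. l * g l) u x) ?z \<le> 0"
    by (rule laplacian_op_nonpos[OF calculus_laplacian[OF g lg u]])
  hence "0 \<le> l2_inner \<mu> (calculus (\<lambda>l. l * g l) u) ?z"
    by (simp add: l2_inner_def infsum_uminus)
  also have "\<dots> = \<S> (\<lambda>l. l * g l) ?z u"
    using calculus_inner[OF lg u z] spectral_integral_commute[OF lg u z] by simp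
  also have "\<dots> = \<S> (\<lambda>l. l * g l * g l) u u" by (rule spectral_integral_calculus[OF lg g u u])
  also have "\<dots> = (\<integral>l. l * g l * g l \<partial>\<nu> u)"
    by (rule spectral_integral_self[OF bounded_borel_mult[OF lg g] u])
  finally have "(\<integral>l. - (l * g l * g l) \<partial>\<nu> u) \<le> 0" by simp
  moreover have nn: "0 \<le> - (l * g l * g l)" for l
    by (auto simp: g_def indicator_def divide_le_0_iff zero_le_mult_iff)
  moreover have int: "integrable (\<nu> u) (\<lambda>l. - (l * g l * g l))"
    by (intro Bochner_Integration.integrable_minus integrable_spectral_dist u bounded_borel_mult lg g)
  ultimately have "(\<integral>l. - (l * g l * g l) \<partial>\<nu> u) = 0"
    by (intro antisym integral_nonneg_AE) auto
  hence "AE l in \<nu> u. - (l * g l * g l) = 0"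
    using integral_nonneg_eq_0_iff_AE[OF int] nn by simp
  thus ?thesis
  proof (rule AE_mp, intro always_eventually allI impI)
    fix l assume "- (l * g l * g l) = 0"
    thus "0 \<le> l" using pos[of l] by (auto simp: g_def indicator_def split: if_splits)
  qed
qed

section \<open>Heat semigroup and heat kernel\<close>

text \<open>The function \<open>e\<^sup>-\<^sup>t\<^sup>\<lambda>\<close>, altered on the negative half line, which is a null set for the spectral
  measures, so as to be bounded.\<close>

definition heat :: "real \<Rightarrow> real \<Rightarrow> real" where
  "heat t l = exp (- (t * max l 0))"

abbreviation kernel ("\<p>") where "kernel \<equiv> heat_kernel \<mu> E"

lemma heat_le_1: "0 \<le> t \<Longrightarrow> heat t l \<le> 1"
  by (simp add: heat_def)

lemma heat_pos: "0 < heat t l"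
  by (simp add: heat_def)

lemma heat_measurable [measurable]: "heat t \<in> borel_measurable borel"
  unfolding heat_def[abs_def] by measurable

lemma bounded_borel_heat: "0 \<le> t \<Longrightarrow> bounded_borel (heat t)"
  by (rule bounded_borelI[of _ 1]) (use heat_le_1 heat_pos[of t] in \<open>auto simp: abs_of_pos\<close>)

lemma heat_add: "heat t l * heat s l = heat (t + s) l"
  by (simp add: heat_def exp_add[symmetric] algebra_simps)

lemma heat_semigroup_eq:
  assumes t: "0 \<le> t" and u: "u \<in> l2 \<mu>"
  shows "heat_semigroup \<mu> E t u = calculus (heat t) u"
proof -
  let ?e = "\<lambda>l. exp (- t * l)"
  have AE: "AE l in \<nu> z. ?e l = heat t l" if "z \<in> l2 \<mu>" for z
    using spectrum_nonneg[OF that] by eventually_elim (simp add: heat_def max_def)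
  have S: "\<S> ?e z v = \<S> (heat t) z v" if "z \<in> l2 \<mu>" "v \<in> l2 \<mu>" for z v
    by (rule spectral_integral_cong_AE[OF _ _ AE that]) auto
  have "z \<in> spectral_domain \<mu> E ?e" if z: "z \<in> l2 \<mu>" for z
  proof -
    have "integrable (\<nu> z) (\<lambda>l. heat t l * heat t l)"
      by (intro integrable_spectral_dist z bounded_borel_mult bounded_borel_heat t)
    moreover have "AE l in \<nu> z. heat t l * heat t l = (?e l)\<^sup>2"
      using AE[OF z] by eventually_elim (simp add: power2_eq_square)
    moreover have "(\<lambda>l. (?e l)\<^sup>2) \<in> borel_measurable (\<nu> z)"
      by (intro borel_measurable_spectral_dist) measurable
    ultimately have "integrable (\<nu> z) (\<lambda>l. (?e l)\<^sup>2)"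
      using integrable_cong_AE_imp by blast
    thus ?thesis using z by (simp add: spectral_domain_def)
  qed
  hence dom: "spectral_domain \<mu> E ?e = l2 \<mu>" by (auto simp: spectral_domain_def)
  show ?thesis
    unfolding heat_semigroup_def
  proof (rule the_equality)
    show "(u, calculus (heat t) u) \<in> functional_calculus \<mu> E ?e"
      unfolding functional_calculus_def dom
      using u S calculus_l2[OF bounded_borel_heat[OF t] u] calculus_inner[OF bounded_borel_heat[OF t] u]
      by simp
    fix z assume "(u, z) \<in> functional_calculus \<mu> E ?e"
    hence "l2_inner \<mu> z (indicator {x}) = \<S> (heat t) u (indicator {x})" for x
      unfolding functional_calculus_def dom using S[OF u indicator_in_l2] indicator_in_l2 by auto
    thus "z = calculus (heat t) u"
      using measure_pos by (simp add: l2_inner_indicator calculus_def fun_eq_iff field_simps less_imp_neq[symmetric])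
  qed
qed

lemma heat_kernel_eq:
  assumes t: "0 \<le> t"
  shows "\<p> t x y * \<mu> x * \<mu> y = \<S> (heat t) (indicator {x}) (indicator {y})"
proof -
  have "l2_inner \<mu> (indicator {x}) (heat_semigroup \<mu> E t (indicator {y})) =
      \<S> (heat t) (indicator {y}) (indicator {x})"
    unfolding heat_semigroup_eq[OF t indicator_in_l2]
    using calculus_inner[OF bounded_borel_heat[OF t] indicator_in_l2 indicator_in_l2]
    by (simp add: l2_inner_commute)
  also have "\<dots> = \<S> (heat t) (indicator {x}) (indicator {y})"
    by (rule spectral_integral_commute[OF bounded_borel_heat[OF t] indicator_in_l2 indicator_in_l2])
  finally show ?thesis
    using measure_pos[of x] measure_pos[of y] by (simp add: heat_kernel_def)
qed

lemma heat_kernel_commute: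
  assumes t: "0 \<le> t"
  shows "\<p> t x y = \<p> t y x"
proof -
  have "\<p> t x y * (\<mu> x * \<mu> y) = \<p> t y x * (\<mu> x * \<mu> y)"
    using heat_kernel_eq[OF t, of x y] heat_kernel_eq[OF t, of y x]
      spectral_integral_commute[OF bounded_borel_heat[OF t] indicator_in_l2 indicator_in_l2, of x y]
    by (simp add: mult_ac)
  thus ?thesis using measure_pos[of x] measure_pos[of y] by simp
qed

lemma heat_kernel_column:
  assumes t: "0 \<le> t"
  shows "calculus (heat t) (indicator {x}) y = \<p> t x y * \<mu> x"
  using heat_kernel_eq[OF t, of x y] measure_pos[of y] by (simp add: calculus_def field_simps)

lemma heat_has_sum:
  assumes t: "0 \<le> t" and u: "u \<in> l2 \<mu>"
  shows "((\<lambda>y. \<p> t x y * u y * \<mu> y) has_sum calculus (heat t) u x) UNIV"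
proof -
  let ?k = "calculus (heat t) (indicator {x})"
  have k: "?k \<in> l2 \<mu>" by (rule calculus_l2[OF bounded_borel_heat[OF t] indicator_in_l2])
  have "l2_inner \<mu> ?k u = calculus (heat t) u x * \<mu> x"
    using calculus_inner[OF bounded_borel_heat[OF t] indicator_in_l2 u]
      spectral_integral_commute[OF bounded_borel_heat[OF t] indicator_in_l2 u] measure_pos[of x]
    by (simp add: calculus_def)
  hence "((\<lambda>y. ?k y * u y * \<mu> y) has_sum calculus (heat t) u x * \<mu> x) UNIV"
    using l2_mult_summable[OF k u] by (simp add: l2_inner_def has_sum_iff)
  hence "((\<lambda>y. ?k y * u y * \<mu> y * inverse (\<mu> x)) has_sum calculus (heat t) u x * \<mu> x * inverse (\<mu> x)) UNIV"
    by (rule has_sum_cmult_left)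
  thus ?thesis
    using measure_pos[of x] by (simp add: heat_kernel_column[OF t] field_simps)
qed

section \<open>Positivity of the heat kernel\<close>

text \<open>The function \<open>1/(1 + s \<lambda>)\<close>, cut off on the negative half line, where it has a pole.\<close>

definition resolvent :: "real \<Rightarrow> real \<Rightarrow> real" where
  "resolvent s l = indicator {0..} l / (1 + s * l)"

lemma
  assumes s: "0 < s"
  shows bounded_borel_resolvent: "bounded_borel (resolvent s)"
    and resolvent_bound: "0 \<le> resolvent s l" "resolvent s l \<le> 1"
    and bounded_borel_id_resolvent: "bounded_borel (\<lambda>l. l * resolvent s l)"
proof -
  have m [measurable]: "resolvent s \<in> borel_measurable borel"
    unfolding resolvent_def[abs_def] by measurable
  show r: "0 \<le> resolvent s l" "resolvent s l \<le> 1" for l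
    using s by (auto simp: resolvent_def indicator_def divide_le_eq_1 add_pos_nonneg)
  show "bounded_borel (resolvent s)"
    by (rule bounded_borelI[OF m, of 1]) (use r in auto)
  show "bounded_borel (\<lambda>l. l * resolvent s l)"
  proof (rule bounded_borelI[of _ "1 / s"])
    show "\<bar>l * resolvent s l\<bar> \<le> 1 / s" for l
    proof (cases "l \<ge> 0")
      case True
      hence "1 + s * l > 0" using s by (simp add: add_pos_nonneg)
      thus ?thesis using True s by (simp add: resolvent_def field_simps)
    qed (use s in \<open>simp add: resolvent_def\<close>)
  qed measurable
qed

text \<open>The vector \<open>z = (1 - s \<Delta>)\<^sup>-\<^sup>1 u\<close> satisfies \<open>z - s \<Delta>z = u\<close>, so the maximum principle applies to it.\<close>

lemma resolvent_nonneg: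
  assumes s: "0 < s" and u: "u \<in> l2 \<mu>" and nonneg: "\<And>x. 0 \<le> u x"
  shows "0 \<le> calculus (resolvent s) u x"
proof (rule maximum_principle[of _ "\<lambda>x. - calculus (\<lambda>l. l * resolvent s l) u x" s])
  note r = bounded_borel_resolvent[OF s] and lr = bounded_borel_id_resolvent[OF s]
  show "(calculus (resolvent s) u, \<lambda>x. - calculus (\<lambda>l. l * resolvent s l) u x) \<in> laplacian_op \<mu> w"
    by (rule calculus_laplacian[OF r lr u])
  show "0 \<le> calculus (resolvent s) u x - s * (- calculus (\<lambda>l. l * resolvent s l) u x)" for x
  proof -
    let ?f = "\<lambda>l. 1 * resolvent s l + s * (l * resolvent s l)"
    have "\<S> ?f u (indicator {x}) = \<S> (\<lambda>_. 1) u (indicator {x})"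
    proof (rule spectral_integral_cong_AE[OF _ _ _ u indicator_in_l2])
      fix z :: "'v \<Rightarrow> real" assume z: "z \<in> l2 \<mu>"
      show "AE l in \<nu> z. ?f l = 1"
        using spectrum_nonneg[OF z]
      proof eventually_elim
        fix l :: real assume l: "0 \<le> l"
        have "1 + s * l > 0" using s l by (simp add: add_pos_nonneg)
        thus "?f l = 1" using l by (simp add: resolvent_def add_divide_distrib[symmetric])
      qed
    qed (intro bounded_borel_measurable bounded_borel_lincomb r lr, simp)
    hence "calculus ?f u x = calculus (\<lambda>_. 1) u x" by (simp add: calculus_def)
    thus ?thesis
      using calculus_lincomb_fun[OF r lr u, of 1 s x] calculus_one[OF u] nonneg[of x] by simp
  qed
qed (rule less_imp_le[OF s])

lemma
  assumes s: "0 < s"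
  shows bounded_borel_resolvent_power: "bounded_borel (\<lambda>l. resolvent s l ^ n)"
    and resolvent_power_nonneg:
      "u \<in> l2 \<mu> \<Longrightarrow> (\<And>x. 0 \<le> u x) \<Longrightarrow> 0 \<le> calculus (\<lambda>l. resolvent s l ^ n) u x"
proof -
  show b: "bounded_borel (\<lambda>l. resolvent s l ^ n)" for n
  proof (induction n)
    case 0
    show ?case by (simp add: bounded_borelI[of _ 1])
  next
    case (Suc n)
    thus ?case using bounded_borel_mult[OF bounded_borel_resolvent[OF s] Suc] by simp
  qed
  show "0 \<le> calculus (\<lambda>l. resolvent s l ^ n) u x" if u: "u \<in> l2 \<mu>" and nn: "\<And>x. 0 \<le> u x"
  proof (induction n arbitrary: x)
    case 0
    show ?case using calculus_one[OF u] nn by simp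
  next
    case (Suc n)
    have "calculus (\<lambda>l. resolvent s l ^ Suc n) u =
        calculus (resolvent s) (calculus (\<lambda>l. resolvent s l ^ n) u)"
      using calculus_mult[OF bounded_borel_resolvent[OF s] b u, of n] by simp
    thus ?case using resolvent_nonneg[OF s calculus_l2[OF b u] Suc] by simp
  qed
qed

text \<open>The functions \<open>(1 + t \<lambda>/n)\<^sup>-\<^sup>n\<close> are bounded by 1 and converge to \<open>e\<^sup>-\<^sup>t\<^sup>\<lambda>\<close>; this is the backward Euler
  scheme for the heat equation.\<close>

lemma heat_nonneg:
  assumes t: "0 < t" and u: "u \<in> l2 \<mu>" and nonneg: "\<And>x. 0 \<le> u x"
  shows "0 \<le> calculus (heat t) u x"
proof -
  let ?s = "\<lambda>n. t / real (Suc n)"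
  let ?f = "\<lambda>n l. resolvent (?s n) l ^ Suc n"
  let ?g = "\<lambda>l. heat t l * indicator {0..} l"
  have s: "?s n > 0" for n using t by simp
  have "(\<lambda>n. \<S> (?f n) u (indicator {x})) \<longlonglongrightarrow> \<S> ?g u (indicator {x})"
  proof (rule spectral_integral_limit[OF _ _ _ _ u indicator_in_l2])
    show "bounded_borel (?f n)" for n by (rule bounded_borel_resolvent_power[OF s])
    show "\<bar>?f n l\<bar> \<le> 1" for n l
      using resolvent_bound[OF s] by (simp add: power_le_one abs_mult power_abs mult_le_one)
    show "bounded_borel ?g"
      using t by (intro bounded_borel_mult bounded_borel_heat bounded_borel_indicator) auto
    show "(\<lambda>n. ?f n l) \<longlonglongrightarrow> ?g l" for l
    proof (cases "l \<ge> 0")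
      case True
      have "(\<lambda>n. (1 + (t * l) / real (Suc n)) ^ Suc n) \<longlonglongrightarrow> exp (t * l)"
        by (rule LIMSEQ_Suc[OF tendsto_exp_limit_sequentially])
      hence "(\<lambda>n. inverse ((1 + (t * l) / real (Suc n)) ^ Suc n)) \<longlonglongrightarrow> inverse (exp (t * l))"
        by (rule tendsto_inverse) simp
      thus ?thesis
        using True by (simp add: resolvent_def heat_def exp_minus power_divide inverse_eq_divide del: power_Suc)
    qed (simp add: resolvent_def)
  qed
  moreover have "0 \<le> \<S> (?f n) u (indicator {x})" for n
    using resolvent_power_nonneg[OF s u nonneg, of n "Suc n" x] measure_pos[of x]
    by (simp add: calculus_def zero_le_divide_iff del: power_Suc)
  ultimately have "0 \<le> \<S> ?g u (indicator {x})" by (intro LIMSEQ_le_const) auto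
  also have "\<S> ?g u (indicator {x}) = \<S> (heat t) u (indicator {x})"
  proof (rule spectral_integral_cong_AE[OF _ _ _ u indicator_in_l2])
    show "AE l in \<nu> z. ?g l = heat t l" if "z \<in> l2 \<mu>" for z
      using spectrum_nonneg[OF that] by eventually_elim simp
  qed measurable
  finally show ?thesis using measure_pos[of x] by (simp add: calculus_def)
qed

lemma heat_kernel_nonneg: "0 < t \<Longrightarrow> 0 \<le> \<p> t x y"
  using heat_nonneg[OF _ indicator_in_l2, of t x y] heat_kernel_column[of t x y] measure_pos[of x]
  by (simp add: zero_le_mult_iff)

lemma heat_kernel_diagonal:
  assumes "0 \<le> t"
  shows "\<p> t x x * \<mu> x * \<mu> x = (\<integral>l. heat t l \<partial>\<nu> (indicator {x}))"
  using heat_kernel_eq[OF assms, of x x]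
    spectral_integral_self[OF bounded_borel_heat[OF assms] indicator_in_l2] by simp

lemma measure_spectral_dist_indicator: "measure (\<nu> (indicator {x})) UNIV = \<mu> x"
  using measure_spectral_dist[OF indicator_in_l2, of UNIV x] E_UNIV[OF indicator_in_l2, of x]
  by (simp add: l2_inner_indicator)

lemma heat_kernel_diagonal_pos:
  assumes t: "0 \<le> t"
  shows "0 < \<p> t x x"
proof -
  let ?M = "\<nu> (indicator {x})"
  interpret finite_measure ?M by (rule finite_measure_spectral_dist[OF indicator_in_l2])
  have "(\<integral>l. heat t l \<partial>?M) \<noteq> 0"
  proof
    assume "(\<integral>l. heat t l \<partial>?M) = 0"
    hence "AE l in ?M. heat t l = 0"
      using integral_nonneg_eq_0_iff_AE[OF integrable_spectral_dist[OF indicator_in_l2 bounded_borel_heat[OF t]]]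
        heat_pos by (simp add: less_imp_le)
    hence "AE l in ?M. False" by eventually_elim (use heat_pos less_irrefl in metis)
    hence "measure ?M UNIV = 0"
      by (simp add: AE_iff_null null_sets_def measure_def)
    thus False using measure_spectral_dist_indicator[of x] measure_pos[of x] by simp
  qed
  moreover have "0 \<le> (\<integral>l. heat t l \<partial>?M)" using heat_pos by (intro integral_nonneg_AE) (simp add: less_imp_le)
  ultimately show ?thesis
    using heat_kernel_diagonal[OF t, of x] measure_pos[of x] by (metis order_le_less zero_less_mult_pos2)
qed

text \<open>One term of the Chapman-Kolmogorov sum, whose other terms are nonnegative.\<close>

lemma heat_kernel_chain:
  assumes t: "0 < t" and s: "0 < s"
  shows "\<p> t x y * \<p> s y z * \<mu> y \<le> \<p> (t + s) x z"
proof -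
  let ?u = "calculus (heat s) (indicator {z})"
  have u: "?u \<in> l2 \<mu>" using s by (intro calculus_l2 bounded_borel_heat indicator_in_l2) auto
  have u_eq: "?u y = \<p> s y z * \<mu> z" for y
    using heat_kernel_column[of s z y] heat_kernel_commute[of s z y] s by simp
  have "calculus (heat t) ?u = calculus (heat (t + s)) (indicator {z})"
    using t s by (subst calculus_mult) (auto intro: bounded_borel_heat indicator_in_l2 simp: heat_add)
  hence "((\<lambda>y. \<p> t x y * ?u y * \<mu> y) has_sum (\<p> (t + s) x z * \<mu> z)) UNIV"
    using heat_has_sum[of t ?u x] u t s heat_kernel_column[of "t + s" z x]
      heat_kernel_commute[of "t + s" z x] by simp
  hence "(\<Sum>y\<in>{y}. \<p> t x y * ?u y * \<mu> y) \<le> \<p> (t + s) x z * \<mu> z"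
    using heat_kernel_nonneg t s measure_pos
    by (intro finite_sum_le_has_sum) (auto simp: u_eq less_imp_le)
  hence "(\<p> t x y * \<p> s y z * \<mu> y) * \<mu> z \<le> \<p> (t + s) x z * \<mu> z"
    by (simp add: u_eq mult_ac)
  thus ?thesis using measure_pos[of z] by simp
qed

lemma indicator_spectral_domain:
  "(indicator {y}, \<lambda>x. - laplacian \<mu> w (indicator {y}) x) \<in> functional_calculus \<mu> E (\<lambda>l. l)"
proof -
  have "(indicator {y}, laplacian \<mu> w (indicator {y})) \<in> laplacian_op \<mu> w"
    unfolding laplacian_op_def op_closure_def mem_Collect_eq split
  proof (intro conjI exI allI)
    show "(indicator {y}, laplacian \<mu> w (indicator {y})) \<in> laplacian_finsupp \<mu> w"
      using indicator_finsupp by (auto simp: laplacian_finsupp_def)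
  qed (use indicator_in_l2 laplacian_l2[OF indicator_finsupp] in
        \<open>auto simp: l2_norm_def l2_inner_def\<close>)
  thus ?thesis by (simp add: laplacian_op_iff)
qed

text \<open>The derivative at time 0 of the matrix coefficient \<open>\<langle>1\<^sub>x, e\<^sup>t\<^sup>\<Delta> 1\<^sub>y\<rangle>\<close> is \<open>\<langle>1\<^sub>x, \<Delta>1\<^sub>y\<rangle> = w(x,y)\<close>. The
  difference quotients of \<open>e\<^sup>-\<^sup>t\<^sup>\<lambda>\<close> are dominated by \<open>\<lambda>\<close>, and the point masses are in the domain of
  the Laplacian.\<close>

lemma heat_kernel_edge:
  assumes xy: "x \<noteq> y"
  shows "(\<lambda>n. real (Suc n) * \<p> (1 / real (Suc n)) x y * \<mu> x * \<mu> y) \<longlonglongrightarrow> w x y"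
proof -
  let ?t = "\<lambda>n. 1 / real (Suc n)"
  let ?x = "indicator {x} :: 'v \<Rightarrow> real" and ?y = "indicator {y} :: 'v \<Rightarrow> real"
  let ?f = "\<lambda>n l. real (Suc n) * heat (?t n) l + (- real (Suc n)) * 1"
  note x2 = indicator_in_l2[of x] and y2 = indicator_in_l2[of y]
  have dom: "?x \<in> spectral_domain \<mu> E (\<lambda>l. l)" "?y \<in> spectral_domain \<mu> E (\<lambda>l. l)"
    using indicator_spectral_domain by (auto simp: functional_calculus_def)
  have one: "bounded_borel (\<lambda>_. 1)" by (rule bounded_borelI[of _ 1]) auto
  have "(\<lambda>n. \<S> (?f n) ?y ?x) \<longlonglongrightarrow> \<S> (\<lambda>l. - max l 0) ?y ?x"
  proof (rule spectral_integral_dominated[OF _ dom(2,1)])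
    show "\<bar>?f n l\<bar> \<le> \<bar>l\<bar>" for n l
    proof -
      have "1 - heat (?t n) l \<le> ?t n * max l 0"
        using exp_ge_add_one_self[of "- (?t n * max l 0)"] by (simp add: heat_def)
      hence "real (Suc n) * (1 - heat (?t n) l) \<le> max l 0"
        by (simp add: field_simps)
      moreover have "0 \<le> real (Suc n) * (1 - heat (?t n) l)"
        using heat_le_1[of "?t n" l] by simp
      ultimately show ?thesis by (simp add: algebra_simps abs_le_iff)
    qed
    show "(\<lambda>n. ?f n l) \<longlonglongrightarrow> - max l 0" for l
    proof -
      have "((\<lambda>t. exp (- (t * max l 0))) has_real_derivative - max l 0) (at 0)"
        by (auto intro!: derivative_eq_intros)
      hence "(\<lambda>h. (exp (- (h * max l 0)) - 1) / h) \<midarrow>0\<rightarrow> - max l 0"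
        by (simp add: DERIV_def)
      moreover have "filterlim ?t (at 0) sequentially"
        unfolding filterlim_at using LIMSEQ_inverse_real_of_nat by (auto simp: inverse_eq_divide)
      ultimately have "(\<lambda>n. (exp (- (?t n * max l 0)) - 1) / ?t n) \<longlonglongrightarrow> - max l 0"
        by (rule filterlim_compose)
      thus ?thesis by (simp add: heat_def algebra_simps)
    qed
  qed measurable
  moreover have "\<S> (?f n) ?y ?x = real (Suc n) * \<p> (?t n) x y * \<mu> x * \<mu> y" for n
  proof -
    have h: "bounded_borel (heat (?t n))" by (rule bounded_borel_heat) simp
    have "\<S> (\<lambda>_. 1) ?y ?x = 0"
      using fun_cong[OF calculus_one[OF y2], of x] xy measure_pos[of x] by (simp add: calculus_def)
    thus ?thesis
      using spectral_integral_lincomb_fun[OF h one y2 x2] heat_kernel_eq[of "?t n" x y]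
        spectral_integral_commute[OF h y2 x2] by simp
  qed
  moreover have "\<S> (\<lambda>l. - max l 0) ?y ?x = w x y"
  proof -
    have "\<S> (\<lambda>l. - max l 0) ?y ?x = \<S> (\<lambda>l. - l) ?y ?x"
    proof (rule spectral_integral_cong_AE[OF _ _ _ y2 x2])
      show "AE l in \<nu> z. - max l 0 = - l" if "z \<in> l2 \<mu>" for z
        using spectrum_nonneg[OF that] by eventually_elim simp
    qed measurable
    also have "\<dots> = - \<S> (\<lambda>l. l) ?y ?x" by (simp add: spectral_integral_def field_simps)
    also have "\<dots> = - l2_inner \<mu> (\<lambda>x. - laplacian \<mu> w ?y x) ?x"
      using indicator_spectral_domain[of y] dom(1) by (simp add: functional_calculus_def)
    also have "\<dots> = w x y" by (simp add: l2_inner_indicator laplacian_indicator[OF xy])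
    finally show ?thesis .
  qed
  ultimately show ?thesis by simp
qed

text \<open>At an edge the kernel is positive at some time \<open>s\<close> smaller than \<open>t\<close>, and \<open>p(t - s,x,x) > 0\<close>
  covers the remaining time. A path is dealt with by splitting the time.\<close>

lemma heat_kernel_pos:
  assumes connected: "connected_graph w" and t: "0 < t"
  shows "0 < \<p> t x y"
proof -
  have edge: "0 < \<p> t x y" if "w x y > 0" "0 < t" for x y t
  proof -
    have xy: "x \<noteq> y" using that(1) weight_irrefl by auto
    have "\<forall>\<^sub>F n in sequentially. 0 < real (Suc n) * \<p> (1 / real (Suc n)) x y * \<mu> x * \<mu> y"
      by (rule order_tendstoD(1)[OF heat_kernel_edge[OF xy] that(1)])
    moreover have "\<forall>\<^sub>F n in sequentially. 1 / real (Suc n) < t"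
      using order_tendstoD(2)[OF LIMSEQ_inverse_real_of_nat that(2)] by (simp add: inverse_eq_divide)
    ultimately have "\<forall>\<^sub>F n in sequentially. 0 < real (Suc n) * \<p> (1 / real (Suc n)) x y * \<mu> x * \<mu> y
        \<and> 1 / real (Suc n) < t" by eventually_elim auto
    then obtain n where n: "0 < real (Suc n) * \<p> (1 / real (Suc n)) x y * \<mu> x * \<mu> y"
      "1 / real (Suc n) < t" by (auto dest: eventually_happens)
    define s where "s = 1 / real (Suc n)"
    have s: "0 < s" "s < t" using n by (auto simp: s_def)
    have "0 < \<p> s x y"
      using n(1) measure_pos[of x] measure_pos[of y] by (simp add: s_def zero_less_mult_iff del: of_nat_Suc)
    hence "0 < \<p> (t - s) x x * \<p> s x y * \<mu> x"
      using heat_kernel_diagonal_pos[of "t - s" x] s measure_pos[of x] by simp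
    also have "\<dots> \<le> \<p> (t - s + s) x y" by (rule heat_kernel_chain) (use s in auto)
    finally show ?thesis by simp
  qed
  have "(x, y) \<in> {(a, b). w a b > 0}\<^sup>*" using connected by (simp add: connected_graph_def)
  thus ?thesis using t
  proof (induction arbitrary: t rule: rtrancl_induct)
    case base
    thus ?case by (intro heat_kernel_diagonal_pos) simp
  next
    case (step y z)
    have "0 < \<p> (t / 2) x y * \<p> (t / 2) y z * \<mu> y"
      using step edge[of y z "t / 2"] measure_pos[of y] by (intro mult_pos_pos) auto
    also have "\<dots> \<le> \<p> (t / 2 + t / 2) x z" by (rule heat_kernel_chain) (use step in auto)
    finally show ?case by simp
  qed
qed

end

section \<open>The derivative of the Gamma function at 1\<close>

lemma set_integral_dominated_limit:
  fixes f :: "nat \<Rightarrow> real \<Rightarrow> real"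
  assumes A: "A \<in> sets borel" and f: "\<And>n. f n \<in> borel_measurable borel" and g: "g \<in> borel_measurable borel"
    and h: "set_integrable lborel A h" and bound: "\<And>n t. t \<in> A \<Longrightarrow> \<bar>f n t\<bar> \<le> h t"
    and lim: "\<And>t. t \<in> A \<Longrightarrow> (\<lambda>n. f n t) \<longlonglongrightarrow> g t"
  shows "set_integrable lborel A g" "(\<lambda>n. LINT t:A|lborel. f n t) \<longlonglongrightarrow> (LINT t:A|lborel. g t)"
proof -
  have *: "(\<lambda>t. indicator A t *\<^sub>R g t) \<in> borel_measurable lborel"
    "\<And>n. (\<lambda>t. indicator A t *\<^sub>R f n t) \<in> borel_measurable lborel"
    using A f g by measurable
  have **: "AE t in lborel. (\<lambda>n. indicator A t *\<^sub>R f n t) \<longlonglongrightarrow> indicator A t *\<^sub>R g t"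
    using lim by (intro always_eventually) (auto simp: indicator_def)
  have ***: "AE t in lborel. norm (indicator A t *\<^sub>R f n t) \<le> indicator A t *\<^sub>R h t" for n
    using bound by (intro always_eventually) (auto simp: indicator_def)
  show "set_integrable lborel A g" "(\<lambda>n. LINT t:A|lborel. f n t) \<longlonglongrightarrow> (LINT t:A|lborel. g t)"
    unfolding set_integrable_def set_lebesgue_integral_def
    using integrable_dominated_convergence[OF * h[unfolded set_integrable_def] ** ***]
      integral_dominated_convergence[OF * h[unfolded set_integrable_def] ** ***] .
qed

lemma one_minus_exp_le: "1 - exp (- t) \<le> (t::real)"
  using exp_ge_add_one_self[of "- t"] by simp

text \<open>For \<open>s > 0\<close>, Euler's integral gives
  \<open>\<Gamma>(s) - 1/s = (\<integral>\<^sub>0\<^sup>1 t\<^sup>s\<^sup>-\<^sup>1 (e\<^sup>-\<^sup>t - 1) dt) + (\<integral>\<^sub>1\<^sup>\<infinity> t\<^sup>s\<^sup>-\<^sup>1 e\<^sup>-\<^sup>t dt)\<close>, and the left-hand side is the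
  difference quotient \<open>(\<Gamma>(1 + s) - \<Gamma>(1))/s\<close>. For \<open>s \<le> 1\<close> the integrands on the right are
  dominated by 1 and by \<open>e\<^sup>-\<^sup>t\<close>, so that \<open>s\<close> may tend to 0 under the integrals.\<close>

lemma
  shows exp_quotient_integrable_0: "set_integrable lborel {0<..1} (\<lambda>t::real. (exp (- t) - 1) / t)"
    and exp_quotient_integrable_1: "set_integrable lborel {1..} (\<lambda>t::real. exp (- t) / t)"
    and deriv_Gamma_1_integral:
      "(LINT t:{0<..1}|lborel. (exp (- t) - 1) / t) + (LINT t:{1..}|lborel. exp (- t) / t) =
        deriv Gamma (1::real)"
proof -
  let ?g = "\<lambda>s t::real. t powr (s - 1) / exp t"
  have g: "set_integrable lborel {0..} (?g s)" "(LINT t:{0..}|lborel. ?g s t) = Gamma s" if "s > 0" for s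
  proof -
    have "(\<integral>\<^sup>+t. ennreal (indicator {0..} t *\<^sub>R ?g s t) \<partial>lborel) = ennreal (Gamma s)"
      using Gamma_conv_nn_integral_real[OF that] by simp
    hence "integrable lborel (\<lambda>t. indicator {0..} t *\<^sub>R ?g s t) \<and>
        (\<integral>t. indicator {0..} t *\<^sub>R ?g s t \<partial>lborel) = Gamma s"
      using that by (subst (asm) nn_integral_eq_integrable) (auto simp: less_imp_le)
    thus "set_integrable lborel {0..} (?g s)" "(LINT t:{0..}|lborel. ?g s t) = Gamma s"
      by (auto simp: set_integrable_def set_lebesgue_integral_def)
  qed
  define s where "s = (\<lambda>n. 1 / real (Suc n))"
  have s: "0 < s n" "s n \<le> 1" for n by (auto simp: s_def)
  have s0: "s \<longlonglongrightarrow> 0" unfolding s_def using LIMSEQ_inverse_real_of_nat by (simp add: inverse_eq_divide)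
  let ?f = "\<lambda>n t::real. t powr (s n - 1) * (exp (- t) - 1)"
  let ?h = "\<lambda>n t::real. t powr (s n - 1) * exp (- t)"
  have tail: "set_integrable lborel {1..} (\<lambda>t::real. exp (- t))"
  proof -
    have "set_integrable lborel {1..} (?g 1)" by (rule set_integrable_subset[OF g(1)]) auto
    also have "?this \<longleftrightarrow> set_integrable lborel {1..} (\<lambda>t::real. exp (- t))"
      by (intro set_integrable_cong) (auto simp: exp_minus field_simps)
    finally show ?thesis .
  qed
  have near: "set_integrable lborel {0..1} (\<lambda>_ :: real. 1 :: real)"
    unfolding set_integrable_def by (intro integrable_scaleR_left integrable_real_indicator) auto
  have powr_lim: "(\<lambda>n. t powr (s n - 1)) \<longlonglongrightarrow> 1 / t" if "t \<ge> 0" for t :: real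
  proof (cases "t = 0")
    case False
    have "(\<lambda>n. t powr (s n - 1)) \<longlonglongrightarrow> t powr (0 - 1)"
      using that False by (intro tendsto_intros s0) auto
    thus ?thesis using that False by (simp add: powr_minus inverse_eq_divide)
  qed simp
  have hbound: "\<bar>?h n t\<bar> \<le> exp (- t)" if "t \<in> {1..}" for n t
  proof -
    have "t powr (s n - 1) \<le> t powr 0" using that s(2)[of n] by (intro powr_mono) auto
    thus ?thesis using that by (simp add: abs_mult)
  qed
  have fbound: "\<bar>?f n t\<bar> \<le> 1" if "t \<in> {0..1}" for n t
  proof (cases "t = 0")
    case False
    have "\<bar>exp (- t) - 1\<bar> \<le> t" using one_minus_exp_le[of t] that by simp
    hence "\<bar>?f n t\<bar> \<le> t powr (s n - 1) * t" by (simp add: abs_mult mult_left_mono)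
    also have "\<dots> = t powr s n" using that False by (simp add: powr_diff)
    also have "\<dots> \<le> 1" using that s(1)[of n] by (intro powr_le1) auto
    finally show ?thesis .
  qed simp
  have flim: "(\<lambda>n. ?f n t) \<longlonglongrightarrow> 1 / t * (exp (- t) - 1)" if "t \<in> {0..1}" for t
    using that by (intro tendsto_intros powr_lim) simp
  have hlim: "(\<lambda>n. ?h n t) \<longlonglongrightarrow> 1 / t * exp (- t)" if "t \<in> {1..}" for t
    using that by (intro tendsto_intros powr_lim) simp
  have meas: "?f n \<in> borel_measurable borel" "?h n \<in> borel_measurable borel"
    "(\<lambda>t::real. 1 / t * (exp (- t) - 1)) \<in> borel_measurable borel"
    "(\<lambda>t::real. 1 / t * exp (- t)) \<in> borel_measurable borel" for n by measurable
  note F = set_integral_dominated_limit[OF _ meas(1,3) near fbound flim, simplified]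
  note H = set_integral_dominated_limit[OF _ meas(2,4) tail hbound hlim, simplified]
  \<comment> \<open>Split Euler's integral at 1 and subtract \<open>1 / s\<close>, the integral of \<open>t\<^sup>s\<^sup>-\<^sup>1\<close> over the unit interval.\<close>
  have split: "(LINT t:{0..1}|lborel. ?f n t) + (LINT t:{1..}|lborel. ?h n t) = (Gamma (1 + s n) - Gamma 1) / s n" for n
  proof -
    have gs: "set_integrable lborel {0..1} (?g (s n))" "set_integrable lborel {1..} (?g (s n))"
      by (rule set_integrable_subset[OF g(1)[OF s(1)]]; auto)+
    have p: "set_integrable lborel {0..1} (\<lambda>t. t powr (s n - 1))"
    proof (rule set_integrable_bound[where f = "\<lambda>t. exp 1 * ?g (s n) t"])
      show "AE t in lborel. t \<in> {0..1} \<longrightarrow> norm (t powr (s n - 1)) \<le> norm (exp 1 * ?g (s n) t)"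
      proof (intro always_eventually allI impI)
        fix t :: real assume "t \<in> {0..1}"
        hence "1 \<le> exp (1 - t)" by simp
        hence "t powr (s n - 1) * 1 \<le> t powr (s n - 1) * exp (1 - t)" by (intro mult_left_mono) auto
        thus "norm (t powr (s n - 1)) \<le> norm (exp 1 * ?g (s n) t)" by (simp add: exp_diff mult.commute)
      qed
      show "set_integrable lborel {0..1} (\<lambda>t. exp 1 * ?g (s n) t)"
        by (intro set_integrable_mult_right gs)
    qed (simp add: set_borel_measurable_def)
    have p_int: "(LINT t:{0..1}|lborel. t powr (s n - 1)) = 1 / s n"
      unfolding set_borel_integral_eq_integral(2)[OF p]
      using has_integral_powr_from_0[of "s n - 1" 1] s(1)[of n] by (intro integral_unique) simp
    have "{0::real..} = {0..1} \<union> {1..}" by auto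
    hence "Gamma (s n) = (LINT t:{0..1} \<union> {1..}|lborel. ?g (s n) t)"
      using g(2)[OF s(1)[of n]] by simp
    also have "\<dots> = (LINT t:{0..1}|lborel. ?g (s n) t) + (LINT t:{1..}|lborel. ?g (s n) t)"
    proof (rule set_integral_Un_AE)
      show "AE t in lborel. \<not> (t \<in> {0..1} \<and> t \<in> {1::real..})"
        using AE_lborel_singleton[of 1] by eventually_elim auto
    qed (use gs in auto)
    also have "(LINT t:{1..}|lborel. ?g (s n) t) = (LINT t:{1..}|lborel. ?h n t)"
      by (intro set_lebesgue_integral_cong) (auto simp: exp_minus divide_inverse)
    also have "(LINT t:{0..1}|lborel. ?g (s n) t) =
        (LINT t:{0..1}|lborel. ?f n t) + 1 / s n"
    proof -
      have "(LINT t:{0..1}|lborel. ?f n t) = (LINT t:{0..1}|lborel. ?g (s n) t - t powr (s n - 1))"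
        by (intro set_lebesgue_integral_cong) (auto simp: exp_minus divide_inverse algebra_simps)
      thus ?thesis using set_integral_diff(2)[OF gs(1) p] p_int by simp
    qed
    finally have "Gamma (s n) - 1 / s n = (LINT t:{0..1}|lborel. ?f n t) + (LINT t:{1..}|lborel. ?h n t)"
      by simp
    moreover have "Gamma (1 + s n) = s n * Gamma (s n)"
      using Gamma_plus1[of "s n"] s(1)[of n] nonpos_Ints_nonpos[of "s n"] by (force simp: add.commute)
    ultimately show ?thesis using s(1)[of n] by (simp add: field_simps)
  qed
  have "(Gamma has_field_derivative deriv Gamma 1) (at (1::real))"
    using has_field_derivative_Gamma[of "1::real" UNIV] DERIV_imp_deriv by fastforce
  hence "(\<lambda>h. (Gamma (1 + h) - Gamma 1) / h) \<midarrow>0\<rightarrow> deriv Gamma (1::real)" by (simp add: DERIV_def)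
  moreover have "filterlim s (at 0) sequentially"
    unfolding filterlim_at using s0 s(1) by (auto simp: less_imp_neq[symmetric])
  ultimately have "(\<lambda>n. (Gamma (1 + s n) - Gamma 1) / s n) \<longlonglongrightarrow> deriv Gamma (1::real)"
    by (rule filterlim_compose)
  moreover have "(\<lambda>n. (Gamma (1 + s n) - Gamma 1) / s n) \<longlonglongrightarrow>
      (LINT t:{0..1}|lborel. 1 / t * (exp (- t) - 1)) + (LINT t:{1..}|lborel. 1 / t * exp (- t))"
    using tendsto_add[OF F(2) H(2)] by (simp add: split)
  ultimately have "deriv Gamma (1::real) =
      (LINT t:{0..1}|lborel. 1 / t * (exp (- t) - 1)) + (LINT t:{1..}|lborel. 1 / t * exp (- t))"
    by (rule LIMSEQ_unique)
  moreover have "(LINT t:{0..1}|lborel. 1 / t * (exp (- t) - 1)) =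
      (LINT t:{0<..1}|lborel. (exp (- t) - 1) / (t::real))"
    unfolding set_lebesgue_integral_def by (intro Bochner_Integration.integral_cong) (auto simp: indicator_def)
  moreover have "(LINT t:{1..}|lborel. 1 / t * exp (- t)) = (LINT t:{1..}|lborel. exp (- t) / (t::real))"
    by simp
  ultimately show "(LINT t:{0<..1}|lborel. (exp (- t) - 1) / t) + (LINT t:{1..}|lborel. exp (- t) / t) =
      deriv Gamma (1::real)" by simp
  show "set_integrable lborel {1..} (\<lambda>t::real. exp (- t) / t)" using H(1) by simp
  show "set_integrable lborel {0<..1} (\<lambda>t::real. (exp (- t) - 1) / t)"
    using set_integrable_subset[OF F(1), of "{0<..1}"] by (simp add: subset_iff)
qed

section \<open>The logarithmic Laplacian\<close>

text \<open>Tonelli's theorem for an unordered sum; the order of summation is fixed by an enumeration of the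
  index set.\<close>

lemma integral_has_sum_nonneg:
  fixes f :: "'a \<Rightarrow> 'b \<Rightarrow> real"
  assumes A: "countable A" and f: "\<And>a. a \<in> A \<Longrightarrow> integrable M (f a)"
    and nonneg: "\<And>a t. a \<in> A \<Longrightarrow> 0 \<le> f a t" and g: "integrable M g"
    and sum: "\<And>t. ((\<lambda>a. f a t) has_sum g t) A"
  shows "((\<lambda>a. \<integral>t. f a t \<partial>M) has_sum (\<integral>t. g t \<partial>M)) A"
proof (cases "finite A")
  case True
  have "g t = (\<Sum>a\<in>A. f a t)" for t using sum[of t] True by (simp add: has_sum_finite_iff)
  hence "(\<integral>t. g t \<partial>M) = (\<Sum>a\<in>A. \<integral>t. f a t \<partial>M)" using f by (simp add: Bochner_Integration.integral_sum)
  thus ?thesis using True by (simp add: has_sum_finite_iff)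
next
  case False
  define e where "e = from_nat_into A"
  have e: "bij_betw e UNIV A" unfolding e_def by (rule bij_betw_from_nat_into[OF A False])
  have eA: "e n \<in> A" for n using e by (auto simp: bij_betw_def)
  have sums: "(\<lambda>n. f (e n) t) sums g t" for t
    by (intro has_sum_imp_sums has_sum_reindex_bij_betw[OF e, THEN iffD2] sum)
  have "(\<lambda>n. \<integral>t. f (e n) t \<partial>M) sums (\<integral>t. (\<Sum>n. f (e n) t) \<partial>M)"
  proof (rule sums_integral)
    show "AE t in M. summable (\<lambda>n. norm (f (e n) t))"
      using sums_summable[OF sums] nonneg eA by (intro always_eventually) simp
    show "summable (\<lambda>n. \<integral>t. norm (f (e n) t) \<partial>M)"
    proof (rule summableI_nonneg_bounded)
      fix N
      have "(\<Sum>n<N. \<integral>t. norm (f (e n) t) \<partial>M) = (\<integral>t. (\<Sum>n<N. f (e n) t) \<partial>M)"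
        using f nonneg eA by (simp add: Bochner_Integration.integral_sum)
      also have "\<dots> \<le> (\<integral>t. g t \<partial>M)"
      proof (intro integral_mono g Bochner_Integration.integrable_sum f eA)
        show "(\<Sum>n<N. f (e n) t) \<le> g t" for t
          using sum_le_suminf[OF sums_summable[OF sums], of "{..<N}"] sums_unique[OF sums] nonneg eA by simp
      qed
      finally show "(\<Sum>n<N. \<integral>t. norm (f (e n) t) \<partial>M) \<le> (\<integral>t. g t \<partial>M)" .
    qed (auto intro: integral_nonneg_AE)
  qed (rule f[OF eA])
  hence "(\<lambda>n. \<integral>t. f (e n) t \<partial>M) sums (\<integral>t. g t \<partial>M)" using sums_unique[OF sums] by simp
  hence "((\<lambda>n. \<integral>t. f (e n) t \<partial>M) has_sum (\<integral>t. g t \<partial>M)) UNIV"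
    by (rule sums_nonneg_imp_has_sum) (intro integral_nonneg_AE always_eventually allI nonneg eA)
  thus ?thesis by (simp add: has_sum_reindex_bij_betw[OF e, of "\<lambda>a. \<integral>t. f a t \<partial>M"])
qed

lemma set_integral_pos:
  fixes f :: "real \<Rightarrow> real"
  assumes int: "set_integrable lborel S f" and pos: "\<And>t. t \<in> S \<Longrightarrow> 0 < f t"
    and S: "S \<in> sets borel" "emeasure lborel S \<noteq> 0"
  shows "0 < (LINT t:S|lborel. f t)"
proof -
  let ?f = "\<lambda>t. indicator S t *\<^sub>R f t"
  have nn: "0 \<le> ?f t" for t using pos by (auto simp: indicator_def less_imp_le)
  have "(\<integral>t. ?f t \<partial>lborel) \<noteq> 0"
  proof
    assume "(\<integral>t. ?f t \<partial>lborel) = 0"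
    hence "AE t in lborel. ?f t = 0"
      using integral_nonneg_eq_0_iff_AE[OF int[unfolded set_integrable_def]] nn by simp
    hence "AE t in lborel. t \<notin> S"
      by eventually_elim (use pos in \<open>force simp: indicator_def split: if_splits\<close>)
    hence "S \<in> null_sets lborel" using AE_iff_null_sets[of S lborel] S(1) by simp
    thus False using S(2) by auto
  qed
  moreover have "0 \<le> (\<integral>t. ?f t \<partial>lborel)" using nn by (intro integral_nonneg_AE) simp
  ultimately show ?thesis by (simp add: set_lebesgue_integral_def)
qed

lemma set_integrable_quotient:
  fixes f :: "real \<Rightarrow> real"
  assumes f: "continuous_on {0<..} f" and le: "\<And>t. 0 < t \<Longrightarrow> \<bar>f t\<bar> \<le> t * C"
  shows "set_integrable lborel {0<..1} (\<lambda>t. f t / t)"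
proof (rule set_integrable_bound[where f = "\<lambda>_. C"])
  show "set_borel_measurable lborel {0<..1} (\<lambda>t. f t / t)"
    unfolding set_borel_measurable_def measurable_lborel2
  proof (intro borel_measurable_continuous_on_indicator continuous_on_divide)
    show "continuous_on {0<..1} f" by (rule continuous_on_subset[OF f]) auto
  qed auto
  show "AE t in lborel. t \<in> {0<..1} \<longrightarrow> norm (f t / t) \<le> norm C"
  proof (intro always_eventually allI impI)
    fix t :: real assume t: "t \<in> {0<..1}"
    hence "\<bar>f t\<bar> / t \<le> C" using le[of t] by (simp add: field_simps)
    thus "norm (f t / t) \<le> norm C" using t by simp
  qed
  show "set_integrable lborel {0<..1::real} (\<lambda>_. C)"
    unfolding set_integrable_def by (intro integrable_scaleR_left integrable_real_indicator) auto
qed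

lemma set_integral_sum_finite:
  assumes "finite I" "\<And>i. i \<in> I \<Longrightarrow> set_integrable M S (f i)"
  shows "set_integrable M S (\<lambda>t. \<Sum>i\<in>I. c i * f i t)" 
    "(LINT t:S|M. \<Sum>i\<in>I. c i * f i t) = (\<Sum>i\<in>I. c i * (LINT t:S|M. f i t :: real))"
  using assms
  by (induction I rule: finite_induct)
     (auto simp: set_integrable_def[of _ _ "\<lambda>_. 0"] set_lebesgue_integral_def[of _ _ "\<lambda>_. 0"])

locale log_heat_graph = heat_graph \<mu> w E for \<mu> :: "'v \<Rightarrow> real" and w E +
  assumes connected: "connected_graph w"
    and complete: "stochastically_complete \<mu> E"
    and decay: "\<And>x y. set_integrable lborel {1..} (\<lambda>t. heat_kernel \<mu> E t x y / t)"
begin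

lemma heat_kernel_continuous: "continuous_on {0<..} (\<lambda>t. \<p> t x y)"
  unfolding continuous_on_sequentially comp_def
proof (intro allI ballI impI, elim conjE)
  fix r :: "nat \<Rightarrow> real" and t :: real
  assume t: "t \<in> {0<..}" and r: "\<forall>n. r n \<in> {0<..}" "r \<longlonglongrightarrow> t"
  have r0: "0 \<le> r n" for n using r(1) by (simp add: less_imp_le)
  have "(\<lambda>n. \<S> (heat (r n)) (indicator {x}) (indicator {y})) \<longlonglongrightarrow>
      \<S> (heat t) (indicator {x}) (indicator {y})"
  proof (rule spectral_integral_limit[OF _ _ _ _ indicator_in_l2 indicator_in_l2])
    show "\<bar>heat (r n) l\<bar> \<le> 1" for n l
      using heat_le_1[OF r0[of n]] heat_pos[of "r n" l] by simp
    show "(\<lambda>n. heat (r n) l) \<longlonglongrightarrow> heat t l" for l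
      unfolding heat_def by (intro tendsto_intros r(2))
  qed (use t r0 bounded_borel_heat in auto)
  hence "(\<lambda>n. \<p> (r n) x y * \<mu> x * \<mu> y) \<longlonglongrightarrow> \<p> t x y * \<mu> x * \<mu> y"
    using t heat_kernel_eq[OF r0] by (simp add: heat_kernel_eq)
  hence "(\<lambda>n. \<p> (r n) x y * \<mu> x * \<mu> y / (\<mu> x * \<mu> y)) \<longlonglongrightarrow> \<p> t x y * \<mu> x * \<mu> y / (\<mu> x * \<mu> y)"
    using measure_pos[of x] measure_pos[of y] by (intro tendsto_divide) auto
  thus "(\<lambda>n. \<p> (r n) x y) \<longlonglongrightarrow> \<p> t x y"
    using measure_pos[of x] measure_pos[of y] by (simp add: mult.assoc)
qed

text \<open>By stochastic completeness \<open>1 - p(t,x,x) \<mu>(x)\<close> is the mass that has moved away from \<open>x\<close> by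
  time \<open>t\<close>.\<close>

lemma escape_has_sum:
  assumes "0 \<le> t"
  shows "((\<lambda>y. \<p> t x y * \<mu> y) has_sum (1 - \<p> t x x * \<mu> x)) (UNIV - {x})"
proof (rule has_sum_Diff)
  show "((\<lambda>y. \<p> t x y * \<mu> y) has_sum 1) UNIV"
    using complete assms unfolding stochastically_complete_def by blast
  show "((\<lambda>y. \<p> t x y * \<mu> y) has_sum \<p> t x x * \<mu> x) {x}"
    by (rule has_sum_finiteI) auto
qed simp

text \<open>The integrand of \<open>\<integral> (1 - e\<^sup>-\<^sup>t\<^sup>\<lambda>) d\<langle>E(\<lambda>)1\<^sub>x,1\<^sub>x\<rangle>\<close> is at most \<open>t \<lambda>\<close>, and \<open>\<lambda>\<close> is integrable since \<open>1\<^sub>x\<close> is in the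
  domain of the Laplacian.\<close>

lemma escape_le:
  assumes t: "0 < t"
  shows "1 - \<p> t x x * \<mu> x \<le> t * ((\<integral>l. max l 0 \<partial>\<nu> (indicator {x})) / \<mu> x)"
proof -
  let ?M = "\<nu> (indicator {x})"
  interpret finite_measure ?M by (rule finite_measure_spectral_dist[OF indicator_in_l2])
  have "indicator {x} \<in> spectral_domain \<mu> E (\<lambda>l. l)"
    using indicator_spectral_domain[of x] by (simp add: functional_calculus_def)
  hence "integrable ?M (\<lambda>l. l)" by (intro spectral_domain_integrable) auto
  hence m: "integrable ?M (\<lambda>l. max l 0)" by (intro integrable_max) auto
  have h: "integrable ?M (heat t)" using t by (intro integrable_spectral_dist indicator_in_l2 bounded_borel_heat) simp
  have "\<mu> x - (\<integral>l. heat t l \<partial>?M) = (\<integral>l. 1 - heat t l \<partial>?M)"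
    using h measure_spectral_dist_indicator[of x] by simp
  also have "\<dots> \<le> (\<integral>l. t * max l 0 \<partial>?M)"
  proof (intro integral_mono Bochner_Integration.integrable_diff h integrable_mult_right m)
    show "1 - heat t l \<le> t * max l 0" for l
      using one_minus_exp_le[of "t * max l 0"] by (simp add: heat_def)
  qed simp
  also have "\<dots> = t * (\<integral>l. max l 0 \<partial>?M)" by simp
  finally have "\<mu> x * (1 - \<p> t x x * \<mu> x) \<le> t * (\<integral>l. max l 0 \<partial>?M)"
    using heat_kernel_diagonal[of t x] t by (simp add: algebra_simps)
  thus ?thesis using measure_pos[of x] by (simp add: field_simps)
qed

lemma escape_nonneg: "0 < t \<Longrightarrow> 0 \<le> 1 - \<p> t x x * \<mu> x"
  using heat_kernel_nonneg measure_pos by (intro has_sum_nonneg[OF escape_has_sum]) (auto simp: less_imp_le)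

lemma heat_kernel_le_escape:
  assumes t: "0 < t" and xy: "y \<noteq> x"
  shows "\<p> t x y * \<mu> y \<le> 1 - \<p> t x x * \<mu> x"
proof -
  have "(\<Sum>y\<in>{y}. \<p> t x y * \<mu> y) \<le> 1 - \<p> t x x * \<mu> x"
    using t xy heat_kernel_nonneg measure_pos
    by (intro finite_sum_le_has_sum[OF escape_has_sum]) (auto simp: less_imp_le)
  thus ?thesis by simp
qed

lemma escape_integrable: "set_integrable lborel {0<..1} (\<lambda>t. (1 - \<p> t x x * \<mu> x) / t)"
proof (rule set_integrable_quotient)
  show "\<bar>1 - \<p> t x x * \<mu> x\<bar> \<le> t * ((\<integral>l. max l 0 \<partial>\<nu> (indicator {x})) / \<mu> x)" if "0 < t" for t
    using escape_le[OF that, of x] escape_nonneg[OF that, of x] by simp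
qed (intro continuous_intros heat_kernel_continuous)

lemma heat_kernel_integrable_0:
  assumes "x \<noteq> y"
  shows "set_integrable lborel {0<..1} (\<lambda>t. \<p> t x y / t)"
proof -
  have "set_integrable lborel {0<..1} (\<lambda>t. \<p> t x y * \<mu> y / t)"
  proof (rule set_integrable_quotient)
    show "\<bar>\<p> t x y * \<mu> y\<bar> \<le> t * ((\<integral>l. max l 0 \<partial>\<nu> (indicator {x})) / \<mu> x)" if "0 < t" for t
      using heat_kernel_le_escape[OF that, of y x] escape_le[OF that, of x] assms
        heat_kernel_nonneg[OF that, of x y] measure_pos[of y] by (simp add: abs_of_nonneg)
  qed (intro continuous_intros heat_kernel_continuous)
  hence "set_integrable lborel {0<..1} (\<lambda>t. inverse (\<mu> y) * (\<p> t x y * \<mu> y / t))"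
    by (rule set_integrable_mult_right)
  thus ?thesis using measure_pos[of y] by (simp add: field_simps)
qed

lemma W_log_pos: assumes "x \<noteq> y" shows "0 < W_log \<mu> E x y"
proof -
  have "0 < (LINT t:{0<..1}|lborel. \<p> t x y / t)"
    using heat_kernel_pos[OF connected]
    by (intro set_integral_pos heat_kernel_integrable_0 assms) auto
  thus ?thesis using measure_pos by (simp add: W_log_def)
qed

lemma W_kernel_pos: "0 < W_kernel \<mu> E x y"
proof -
  have "emeasure lborel {1..2::real} \<le> emeasure lborel {1::real..}" by (rule emeasure_mono) auto
  hence "emeasure lborel {1::real..} \<noteq> 0" by auto
  hence "0 < (LINT t:{1..}|lborel. \<p> t x y / t)"
    using heat_kernel_pos[OF connected] by (intro set_integral_pos decay) auto
  thus ?thesis using measure_pos by (simp add: W_kernel_def)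
qed

lemma W_log_commute: "W_log \<mu> E x y = W_log \<mu> E y x"
proof -
  have "(LINT t:{0<..1}|lborel. \<p> t x y / t) = (LINT t:{0<..1}|lborel. \<p> t y x / t)"
    by (intro set_lebesgue_integral_cong) (auto simp: heat_kernel_commute)
  thus ?thesis by (simp add: W_log_def)
qed

lemma W_kernel_commute: "W_kernel \<mu> E x y = W_kernel \<mu> E y x"
proof -
  have "(LINT t:{1..}|lborel. \<p> t x y / t) = (LINT t:{1..}|lborel. \<p> t y x / t)"
    by (intro set_lebesgue_integral_cong) (auto simp: heat_kernel_commute)
  thus ?thesis by (simp add: W_kernel_def)
qed

text \<open>The total jump rate out of \<open>x\<close> is finite: summing under the integral sign leaves the escaping
  mass, which is \<open>O(t)\<close>. Stochastic completeness enters through \<open>escape_has_sum\<close>.\<close>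

lemma W_log_has_sum:
  "((\<lambda>y. W_log \<mu> E x y) has_sum (\<mu> x * (LINT t:{0<..1}|lborel. (1 - \<p> t x x * \<mu> x) / t))) (UNIV - {x})"
proof -
  let ?f = "\<lambda>y t. indicator {0<..1} t *\<^sub>R (\<p> t x y * \<mu> y / t)"
  have f_eq: "?f y = (\<lambda>t. \<mu> y * (indicator {0<..1} t *\<^sub>R (\<p> t x y / t)))" for y by auto
  have "((\<lambda>y. \<integral>t. ?f y t \<partial>lborel) has_sum
      (\<integral>t. indicator {0<..1} t *\<^sub>R ((1 - \<p> t x x * \<mu> x) / t) \<partial>lborel)) (UNIV - {x})"
  proof (rule integral_has_sum_nonneg)
    show "integrable lborel (?f y)" if "y \<in> UNIV - {x}" for y
      using heat_kernel_integrable_0[of x y] that unfolding f_eq set_integrable_def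
      by (intro integrable_mult_right) auto
    show "0 \<le> ?f y t" for y t
      using heat_kernel_nonneg[of t x y] measure_pos[of y] by (auto simp: indicator_def)
    show "integrable lborel (\<lambda>t. indicator {0<..1} t *\<^sub>R ((1 - \<p> t x x * \<mu> x) / t))"
      using escape_integrable[of x] by (simp add: set_integrable_def)
    show "((\<lambda>y. ?f y t) has_sum indicator {0<..1} t *\<^sub>R ((1 - \<p> t x x * \<mu> x) / t)) (UNIV - {x})" for t
    proof (cases "t \<in> {0<..1}")
      case True
      have "((\<lambda>y. \<p> t x y * \<mu> y * inverse t) has_sum (1 - \<p> t x x * \<mu> x) * inverse t) (UNIV - {x})"
        using True by (intro has_sum_cmult_left escape_has_sum) auto
      thus ?thesis using True by (simp add: divide_inverse)
    qed simp
  qed (rule countable_subset[OF _ countable_vertices], simp)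
  hence "((\<lambda>y. \<mu> x * (\<integral>t. ?f y t \<partial>lborel)) has_sum
      \<mu> x * (\<integral>t. indicator {0<..1} t *\<^sub>R ((1 - \<p> t x x * \<mu> x) / t) \<partial>lborel)) (UNIV - {x})"
    by (rule has_sum_cmult_right)
  moreover have "\<mu> x * (\<integral>t. ?f y t \<partial>lborel) = W_log \<mu> E x y" for y
    unfolding f_eq integral_mult_right_zero W_log_def set_lebesgue_integral_def
    by (rule mult.assoc[symmetric])
  ultimately show ?thesis by (simp only: set_lebesgue_integral_def)
qed

lemma heat_semigroup_finsupp:
  assumes t: "0 \<le> t" and u: "u \<in> finsupp"
  shows "heat_semigroup \<mu> E t u x = (\<Sum>y | u y \<noteq> 0. u y * \<mu> y * \<p> t x y)"
proof -
  have "((\<lambda>y. \<p> t x y * u y * \<mu> y) has_sum (\<Sum>y | u y \<noteq> 0. u y * \<mu> y * \<p> t x y)) UNIV"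
    using u by (intro has_sum_finite_neutralI[where B = "{y. u y \<noteq> 0}"]) (auto simp: finsupp_def mult_ac)
  with heat_has_sum[OF t finsupp_in_l2[OF u], of x] show ?thesis
    by (simp add: heat_semigroup_eq[OF t finsupp_in_l2[OF u]] has_sum_unique)
qed

text \<open>Near 0 the integrand splits into a multiple of \<open>(e\<^sup>-\<^sup>t - 1)/t\<close>, a multiple of the escaping mass over
  \<open>t\<close>, and a finite sum over the support of \<open>u\<close> away from \<open>x\<close>; on the rest of the half line into
  a multiple of \<open>e\<^sup>-\<^sup>t/t\<close> and a finite sum over the whole support. Each piece is integrable.\<close>

lemma log_laplacian_formula:
  assumes u: "u \<in> finsupp"
  shows "set_integrable lborel {0<..} (log_laplacian_integrand \<mu> E u x)"
    and "(\<lambda>y. W_log \<mu> E x y * (u x - u y)) summable_on (UNIV - {x})"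
    and "log_laplacian \<mu> E u x =
           1 / \<mu> x * (\<Sum>\<^sub>\<infinity>y\<in>UNIV - {x}. W_log \<mu> E x y * (u x - u y))
           - 1 / \<mu> x * (\<Sum>\<^sub>\<infinity>y. W_kernel \<mu> E x y * u y) + deriv Gamma (1::real) * u x"
proof -
  define F where "F = {y. u y \<noteq> 0}"
  have F: "finite F" using u by (simp add: F_def finsupp_def)
  let ?L = "log_laplacian_integrand \<mu> E u x"
  let ?S = "{0<..1::real}" and ?T = "{1::real..}"
  define D where "D = (LINT t:?S|lborel. (1 - \<p> t x x * \<mu> x) / t)"
  define J where "J = (\<lambda>y. LINT t:?S|lborel. \<p> t x y / t)"
  define K where "K = (\<lambda>y. LINT t:?T|lborel. \<p> t x y / t)"
  let ?near = "\<lambda>t. u x * ((exp (- t) - 1) / t) + u x * ((1 - \<p> t x x * \<mu> x) / t)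
      - (\<Sum>y\<in>F - {x}. (u y * \<mu> y) * (\<p> t x y / t))"
  let ?far = "\<lambda>t. u x * (exp (- t) / t) - (\<Sum>y\<in>F. (u y * \<mu> y) * (\<p> t x y / t))"
  have far_eq: "?L t = ?far t" if "t \<in> ?T" for t
    using that heat_semigroup_finsupp[of t u x] u
    by (simp add: log_laplacian_integrand_def F_def diff_divide_distrib sum_divide_distrib)
  have near_eq: "?L t = ?near t" if t: "t \<in> ?S" for t
  proof -
    have "(\<Sum>y\<in>F. (u y * \<mu> y) * (\<p> t x y / t)) =
        u x * \<mu> x * (\<p> t x x / t) + (\<Sum>y\<in>F - {x}. (u y * \<mu> y) * (\<p> t x y / t))"
    proof (cases "x \<in> F")
      case False
      thus ?thesis by (simp add: F_def)
    qed (rule sum.remove[OF F])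
    thus ?thesis
      using t heat_semigroup_finsupp[of t u x] u
      by (simp add: log_laplacian_integrand_def F_def[symmetric] sum_divide_distrib diff_divide_distrib algebra_simps)
  qed
  have near_sum: "set_integrable lborel ?S (\<lambda>t. \<Sum>y\<in>F - {x}. (u y * \<mu> y) * (\<p> t x y / t))"
    "(LINT t:?S|lborel. \<Sum>y\<in>F - {x}. (u y * \<mu> y) * (\<p> t x y / t)) = (\<Sum>y\<in>F - {x}. u y * \<mu> y * J y)"
    unfolding J_def
    by (rule set_integral_sum_finite[of "F - {x}" lborel ?S "\<lambda>y t. \<p> t x y / t" "\<lambda>y. u y * \<mu> y"];
        use F in \<open>auto intro!: heat_kernel_integrable_0\<close>)+
  note far_sum = set_integral_sum_finite[of F lborel ?T "\<lambda>y t. \<p> t x y / t" "\<lambda>y. u y * \<mu> y", OF F decay]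
  have exp0: "set_integrable lborel ?S (\<lambda>t. u x * ((exp (- t) - 1) / t))"
    by (intro set_integrable_mult_right exp_quotient_integrable_0)
  have esc: "set_integrable lborel ?S (\<lambda>t. u x * ((1 - \<p> t x x * \<mu> x) / t))"
    by (intro set_integrable_mult_right escape_integrable)
  have exp1: "set_integrable lborel ?T (\<lambda>t. u x * (exp (- t) / t))"
    by (intro set_integrable_mult_right exp_quotient_integrable_1)
  have near_int: "set_integrable lborel ?S ?near"
    by (intro set_integral_diff(1) set_integral_add(1) exp0 esc near_sum(1))
  have far_int: "set_integrable lborel ?T ?far"
    by (intro set_integral_diff(1) exp1 far_sum(1))
  have "set_integrable lborel ?S ?L \<longleftrightarrow> set_integrable lborel ?S ?near"
    "set_integrable lborel ?T ?L \<longleftrightarrow> set_integrable lborel ?T ?far"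
    by (rule set_integrable_cong[OF refl refl near_eq], assumption)
       (rule set_integrable_cong[OF refl refl far_eq], assumption)
  with near_int far_int have L_int: "set_integrable lborel ?S ?L" "set_integrable lborel ?T ?L"
    by blast+
  have un: "{0<..} = ?S \<union> ?T" by auto
  show "set_integrable lborel {0<..} ?L"
    unfolding un by (intro set_integrable_Un L_int) auto
  have near_val: "(LINT t:?S|lborel. ?L t) =
      u x * (LINT t:?S|lborel. (exp (- t) - 1) / t) + u x * D - (\<Sum>y\<in>F - {x}. u y * \<mu> y * J y)"
  proof -
    have "(LINT t:?S|lborel. ?L t) = (LINT t:?S|lborel. ?near t)"
      by (intro set_lebesgue_integral_cong) (auto simp: near_eq)
    also have "\<dots> = (LINT t:?S|lborel. u x * ((exp (- t) - 1) / t) + u x * ((1 - \<p> t x x * \<mu> x) / t))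
        - (LINT t:?S|lborel. (\<Sum>y\<in>F - {x}. (u y * \<mu> y) * (\<p> t x y / t)))"
      by (rule set_integral_diff(2)[OF set_integral_add(1)[OF exp0 esc] near_sum(1)])
    also have "(LINT t:?S|lborel. u x * ((exp (- t) - 1) / t) + u x * ((1 - \<p> t x x * \<mu> x) / t)) =
        (LINT t:?S|lborel. u x * ((exp (- t) - 1) / t)) + (LINT t:?S|lborel. u x * ((1 - \<p> t x x * \<mu> x) / t))"
      by (rule set_integral_add(2)[OF exp0 esc])
    finally show ?thesis unfolding near_sum(2) D_def J_def set_integral_mult_right .
  qed
  have far_val: "(LINT t:?T|lborel. ?L t) =
      u x * (LINT t:?T|lborel. exp (- t) / t) - (\<Sum>y\<in>F. u y * \<mu> y * K y)"
  proof -
    have "(LINT t:?T|lborel. ?L t) = (LINT t:?T|lborel. ?far t)"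
      by (intro set_lebesgue_integral_cong) (auto simp: far_eq)
    also have "\<dots> = (LINT t:?T|lborel. u x * (exp (- t) / t)) - (LINT t:?T|lborel. (\<Sum>y\<in>F. (u y * \<mu> y) * (\<p> t x y / t)))"
      by (rule set_integral_diff(2)[OF exp1 far_sum(1)])
    finally show ?thesis unfolding far_sum(2) K_def set_integral_mult_right .
  qed
  have "log_laplacian \<mu> E u x = (LINT t:?S \<union> ?T|lborel. ?L t)" by (simp add: log_laplacian_def un)
  also have "\<dots> = (LINT t:?S|lborel. ?L t) + (LINT t:?T|lborel. ?L t)"
  proof (rule set_integral_Un_AE)
    show "AE t in lborel. \<not> (t \<in> ?S \<and> t \<in> ?T)"
      using AE_lborel_singleton[of 1] by eventually_elim auto
  qed (use L_int in auto)
  also have "\<dots> = u x * deriv Gamma 1 + u x * D - (\<Sum>y\<in>F - {x}. u y * \<mu> y * J y) - (\<Sum>y\<in>F. u y * \<mu> y * K y)"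
    unfolding near_val far_val deriv_Gamma_1_integral[symmetric] by (simp add: algebra_simps)
  finally have log: "log_laplacian \<mu> E u x =
      u x * deriv Gamma 1 + u x * D - (\<Sum>y\<in>F - {x}. u y * \<mu> y * J y) - (\<Sum>y\<in>F. u y * \<mu> y * K y)" .
  have "((\<lambda>y. W_log \<mu> E x y * u x) has_sum (\<mu> x * D * u x)) (UNIV - {x})"
    unfolding D_def by (intro has_sum_cmult_left W_log_has_sum)
  moreover have "((\<lambda>y. - (W_log \<mu> E x y * u y)) has_sum - (\<Sum>y\<in>F - {x}. W_log \<mu> E x y * u y)) (UNIV - {x})"
    using F by (intro has_sum_finite_neutralI[of "F - {x}"]) (auto simp: F_def sum_negf)
  ultimately have "((\<lambda>y. W_log \<mu> E x y * u x + - (W_log \<mu> E x y * u y)) has_sum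
      (\<mu> x * D * u x + - (\<Sum>y\<in>F - {x}. W_log \<mu> E x y * u y))) (UNIV - {x})"
    by (rule has_sum_add)
  hence W: "((\<lambda>y. W_log \<mu> E x y * (u x - u y)) has_sum
      (\<mu> x * D * u x - (\<Sum>y\<in>F - {x}. W_log \<mu> E x y * u y))) (UNIV - {x})"
    by (simp add: right_diff_distrib)
  show "(\<lambda>y. W_log \<mu> E x y * (u x - u y)) summable_on (UNIV - {x})"
    using W by (rule has_sum_imp_summable)
  have "((\<lambda>y. W_kernel \<mu> E x y * u y) has_sum (\<Sum>y\<in>F. W_kernel \<mu> E x y * u y)) UNIV"
    using F by (intro has_sum_finite_neutralI[of F]) (auto simp: F_def)
  note V = infsumI[OF this] infsumI[OF W]
  have WJ: "1 / \<mu> x * (\<Sum>y\<in>F - {x}. W_log \<mu> E x y * u y) = (\<Sum>y\<in>F - {x}. u y * \<mu> y * J y)"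
    using measure_pos[of x] unfolding sum_distrib_left
    by (intro sum.cong) (auto simp: W_log_def J_def)
  have WK: "1 / \<mu> x * (\<Sum>y\<in>F. W_kernel \<mu> E x y * u y) = (\<Sum>y\<in>F. u y * \<mu> y * K y)"
    using measure_pos[of x] unfolding sum_distrib_left
    by (intro sum.cong) (auto simp: W_kernel_def K_def)
  show "log_laplacian \<mu> E u x =
      1 / \<mu> x * (\<Sum>\<^sub>\<infinity>y\<in>UNIV - {x}. W_log \<mu> E x y * (u x - u y))
      - 1 / \<mu> x * (\<Sum>\<^sub>\<infinity>y. W_kernel \<mu> E x y * u y) + deriv Gamma (1::real) * u x"
    unfolding log V
    unfolding right_diff_distrib WJ WK using measure_pos[of x] by simp
qed

end

theorem theorem1p1:
  fixes \<mu> :: "'v \<Rightarrow> real" and w :: "'v \<Rightarrow> 'v \<Rightarrow> real"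
    and E :: "real set \<Rightarrow> ('v \<Rightarrow> real) \<Rightarrow> ('v \<Rightarrow> real)"
  assumes graph: "weighted_graph \<mu> w"
    and infinite: "infinite (UNIV :: 'v set)"
    and connected: "connected_graph w"
    and laplacian_l2: "\<And>u. u \<in> finsupp \<Longrightarrow> laplacian \<mu> w u \<in> l2 \<mu>"
    and esa: "essentially_self_adjoint \<mu> (laplacian_finsupp \<mu> w)"
    and spectral: "is_spectral_measure \<mu> (op_minus (laplacian_op \<mu> w)) E"
    and complete: "stochastically_complete \<mu> E"
    and decay: "\<And>x y. set_integrable lborel {1..} (\<lambda>t. heat_kernel \<mu> E t x y / t)"
  shows "(\<forall>x y. x \<noteq> y \<longrightarrow>
            set_integrable lborel {0<..1} (\<lambda>t. heat_kernel \<mu> E t x y / t) \<and>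
            W_log \<mu> E x y > 0 \<and> W_log \<mu> E x y = W_log \<mu> E y x) \<and>
         (\<forall>x y. W_kernel \<mu> E x y > 0 \<and> W_kernel \<mu> E x y = W_kernel \<mu> E y x) \<and>
         (\<forall>u \<in> finsupp. \<forall>x.
            set_integrable lborel {0<..} (log_laplacian_integrand \<mu> E u x) \<and>
            (\<lambda>y. W_log \<mu> E x y * (u x - u y)) summable_on (UNIV - {x}) \<and>
            log_laplacian \<mu> E u x =
              1 / \<mu> x * (\<Sum>\<^sub>\<infinity>y\<in>UNIV - {x}. W_log \<mu> E x y * (u x - u y))
              - 1 / \<mu> x * (\<Sum>\<^sub>\<infinity>y. W_kernel \<mu> E x y * u y)
              + deriv Gamma (1::real) * u x)"
proof -
  interpret weighted_graph \<mu> w by (rule graph)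
  interpret log_heat_graph \<mu> w E
    using laplacian_l2 spectral connected complete decay
    by unfold_locales (auto simp: is_spectral_measure_def)
  show ?thesis
    by (intro conjI allI impI ballI heat_kernel_integrable_0 W_log_pos W_log_commute
        W_kernel_pos W_kernel_commute log_laplacian_formula)
qed

end
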